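(* Let $K$ be a field, let $s_1,\dots,s_n$ be algebraically independent over $K$, let $F/K(s_1,\dots,s_n)$ be a separable algebraic field extension, and let $R\subseteq F$ be a $K$-subalgebra such that $\theta_{\boldsymbol s}:F\to F[[T_1,\dots,T_n]]$ restricts to a higher derivation on $R$ (i.e. $\theta_{\boldsymbol s}(R)\subseteq R[[T_1,\dots,T_n]]$). Let $t_1,\dots,t_n\in R$ be such that the determinant of the Jacobian matrix $J(\boldsymbol t,\boldsymbol s)$ is invertible in $R$. Then $t_1,\dots,t_n$ are algebraically independent over $K$, and the higher derivation $\theta_{\boldsymbol t}$ with respect to $\boldsymbol t=(t_1,\dots,t_n)$ on $K[t_1,\dots,t_n]$ can uniquely be extended to an iterative higher derivation on $R$.
   Context: $\mathbb N$ contains $0$; multi-index notation is used, with $\binom{\boldsymbol\alpha}{\boldsymbol\beta}=\prod_i\binom{\alpha_i}{\beta_i}$. An $n$-variate higher derivation on a commutative ring $R$ is a ring homomorphism $\theta:R\to R[[T_1,\dots,T_n]]$ with $\theta(r)|_{\boldsymbol T=\boldsymbol 0}=r$ for all $r\in R$; $\theta^{(\boldsymbol\alpha)}(r)$ denotes the coefficient of $\boldsymbol T^{\boldsymbol\alpha}$ in $\theta(r)$. It is iterative if $\theta^{(\boldsymbol\alpha)}\circ\theta^{(\boldsymbol\beta)}=\binom{\boldsymbol\alpha+\boldsymbol\beta}{\boldsymbol\alpha}\theta^{(\boldsymbol\alpha+\boldsymbol\beta)}$ for all $\boldsymbol\alpha,\boldsymbol\beta\in\mathbb N^n$. For algebraically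 independent $t_1,\dots,t_n$ over $K$, the higher derivation with respect to $\boldsymbol t$ on $K[t_1,\dots,t_n]$ is the $K$-algebra homomorphism $\theta_{\boldsymbol t}:K[t_1,\dots,t_n]\to K[t_1,\dots,t_n][[T_1,\dots,T_n]]$ with $\theta_{\boldsymbol t}(t_i)=t_i+T_i$. Higher derivations extend uniquely along localizations and separable algebraic field extensions; in particular $\theta_{\boldsymbol s}$ on $K[s_1,\dots,s_n]$ extends uniquely to $F$, and this extension is again denoted $\theta_{\boldsymbol s}$. $J(\boldsymbol t,\boldsymbol s)$ is the $n\times n$ matrix whose $(i,j)$ entry is $\theta_{\boldsymbol s}^{(\boldsymbol e_j)}(t_i)=\partial t_i/\partial s_j$, where $\boldsymbol e_j$ is the $j$-th unit vector. *)

theory Defs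
  imports "HOL-Analysis.Analysis" "HOL-Library.Poly_Mapping"
begin

section \<open>Power series in finitely many variables\<close>

text \<open>
  The variables are indexed by a finite type \<open>'n\<close>, and the multi-indices are the elements of
  \<open>nat^'n\<close>; in particular \<open>axis i 1\<close> is the \<open>i\<close>-th unit vector.
\<close>

typedef (overloaded) ('a, 'n) mps = "UNIV :: (nat^'n::finite \<Rightarrow> 'a) set"
  morphisms mps_nth Abs_mps by simp

setup_lifting type_definition_mps

lemma mps_eqI: "(\<And>\<alpha>. mps_nth f \<alpha> = mps_nth g \<alpha>) \<Longrightarrow> f = g"
  by transfer auto

definition index_splits :: "nat^'n::finite \<Rightarrow> ((nat^'n) \<times> (nat^'n)) set" where
  "index_splits \<alpha> = {(\<beta>, \<gamma>). \<beta> + \<gamma> = \<alpha>}"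

lemma in_index_splits [simp]: "(\<beta>, \<gamma>) \<in> index_splits \<alpha> \<longleftrightarrow> \<beta> + \<gamma> = \<alpha>"
  by (simp add: index_splits_def)

lemma finite_atMost_multiindex: "finite {\<beta> :: nat^'n::finite. \<forall>i. \<beta> $ i \<le> \<alpha> $ i}"
proof -
  have "{\<beta> :: nat^'n. \<forall>i. \<beta> $ i \<le> \<alpha> $ i} \<subseteq> vec_lambda ` (\<Pi>\<^sub>E i\<in>UNIV. {..\<alpha> $ i})"
  proof
    fix \<beta> :: "nat^'n" assume "\<beta> \<in> {\<beta>. \<forall>i. \<beta> $ i \<le> \<alpha> $ i}"
    then have "vec_nth \<beta> \<in> (\<Pi>\<^sub>E i\<in>UNIV. {..\<alpha> $ i})" by auto
    moreover have "\<beta> = vec_lambda (vec_nth \<beta>)" by simp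
    ultimately show "\<beta> \<in> vec_lambda ` (\<Pi>\<^sub>E i\<in>UNIV. {..\<alpha> $ i})" by blast
  qed
  then show ?thesis
    by (rule finite_subset) (intro finite_imageI finite_PiE; simp)
qed

lemma finite_index_splits [simp]: "finite (index_splits \<alpha>)"
proof (rule finite_subset)
  show "index_splits \<alpha> \<subseteq> {\<beta>. \<forall>i. \<beta> $ i \<le> \<alpha> $ i} \<times> {\<beta>. \<forall>i. \<beta> $ i \<le> \<alpha> $ i}"
    by (auto simp: index_splits_def)
qed (simp add: finite_atMost_multiindex)

lemma index_splits_0 [simp]: "index_splits 0 = {(0, 0)}"
  by (auto simp: index_splits_def vec_eq_iff)

instantiation mps :: (comm_ring_1, finite) comm_ring_1
begin

lift_definition zero_mps :: "('a, 'b) mps" is "\<lambda>_. 0" .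

lift_definition one_mps :: "('a, 'b) mps" is "\<lambda>\<alpha>. if \<alpha> = 0 then 1 else 0" .

lift_definition plus_mps :: "('a, 'b) mps \<Rightarrow> ('a, 'b) mps \<Rightarrow> ('a, 'b) mps"
  is "\<lambda>f g \<alpha>. f \<alpha> + g \<alpha>" .

lift_definition minus_mps :: "('a, 'b) mps \<Rightarrow> ('a, 'b) mps \<Rightarrow> ('a, 'b) mps"
  is "\<lambda>f g \<alpha>. f \<alpha> - g \<alpha>" .

lift_definition uminus_mps :: "('a, 'b) mps \<Rightarrow> ('a, 'b) mps"
  is "\<lambda>f \<alpha>. - f \<alpha>" .

lift_definition times_mps :: "('a, 'b) mps \<Rightarrow> ('a, 'b) mps \<Rightarrow> ('a, 'b) mps"
  is "\<lambda>f g \<alpha>. \<Sum>(\<beta>, \<gamma>)\<in>index_splits \<alpha>. f \<beta> * g \<gamma>" .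

instance
proof
  fix f g h :: "('a, 'b) mps"
  show "f + g + h = f + (g + h)" by transfer (simp add: add.assoc)
  show "f + g = g + f" by transfer (simp add: add.commute)
  show "0 + f = f" by transfer simp
  show "- f + f = 0" by transfer simp
  show "f - g = f + - g" by transfer simp
  show "(f + g) * h = f * h + g * h"
    by transfer (simp add: case_prod_unfold ring_distribs sum.distrib)
  show "f * g = g * f"
    by (transfer, rule ext, rule sum.reindex_bij_witness[where i = prod.swap and j = prod.swap])
       (auto simp: add.commute mult.commute)
  show "1 * f = f"
  proof (rule mps_eqI)
    fix \<alpha> :: "nat^'b"
    have "mps_nth (1 * f) \<alpha> = (\<Sum>p\<in>index_splits \<alpha>. if fst p = 0 then mps_nth f (snd p) else 0)"
      unfolding times_mps.rep_eq by (intro sum.cong) (auto simp: one_mps.rep_eq)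
    also have "\<dots> = (\<Sum>p\<in>{(0 :: nat^'b, \<alpha>)}. if fst p = 0 then mps_nth f (snd p) else 0)"
      by (rule sum.mono_neutral_right) auto
    finally show "mps_nth (1 * f) \<alpha> = mps_nth f \<alpha>" by simp
  qed
  show "(f * g) * h = f * (g * h)"
  proof (rule mps_eqI)
    fix \<alpha> :: "nat^'b"
    let ?f = "mps_nth f" and ?g = "mps_nth g" and ?h = "mps_nth h"
    have "mps_nth ((f * g) * h) \<alpha> =
        (\<Sum>p\<in>index_splits \<alpha>. \<Sum>q\<in>index_splits (fst p). ?f (fst q) * ?g (snd q) * ?h (snd p))"
      by (simp add: times_mps.rep_eq case_prod_unfold sum_distrib_right)
    also have "\<dots> = (\<Sum>(p, q)\<in>(SIGMA p:index_splits \<alpha>. index_splits (fst p)).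
        ?f (fst q) * ?g (snd q) * ?h (snd p))"
      by (rule sum.Sigma) auto
    also have "\<dots> = (\<Sum>(p, q)\<in>(SIGMA p:index_splits \<alpha>. index_splits (snd p)).
        ?f (fst p) * (?g (fst q) * ?h (snd q)))"
      by (rule sum.reindex_bij_witness
          [where i = "\<lambda>(p, q). ((fst p + fst q, snd q), (fst p, fst q))"
             and j = "\<lambda>(p, q). ((fst q, snd q + snd p), (snd q, snd p))"])
         (auto simp: add.assoc mult.assoc)
    also have "\<dots> = (\<Sum>p\<in>index_splits \<alpha>. \<Sum>q\<in>index_splits (snd p).
        ?f (fst p) * (?g (fst q) * ?h (snd q)))"
      by (rule sum.Sigma[symmetric]) auto
    also have "\<dots> = mps_nth (f * (g * h)) \<alpha>"
      by (simp add: times_mps.rep_eq case_prod_unfold sum_distrib_left)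
    finally show "mps_nth ((f * g) * h) \<alpha> = mps_nth (f * (g * h)) \<alpha>" .
  qed
  show "(0 :: ('a, 'b) mps) \<noteq> 1"
  proof
    assume "(0 :: ('a, 'b) mps) = 1"
    then have "mps_nth (0 :: ('a, 'b) mps) 0 = mps_nth 1 0" by simp
    then show False by (simp add: zero_mps.rep_eq one_mps.rep_eq)
  qed
qed

end

lift_definition mps_const :: "'a::zero \<Rightarrow> ('a, 'n::finite) mps" is
  "\<lambda>c \<alpha>. if \<alpha> = 0 then c else 0" .

text \<open>The variable \<open>T\<^sub>i\<close>.\<close>

lift_definition mps_var :: "'n::finite \<Rightarrow> ('a::zero_neq_one, 'n) mps" is
  "\<lambda>i \<alpha>. if \<alpha> = axis i 1 then 1 else 0" .

text \<open>\<open>mps_over A\<close> is \<open>A[[T]]\<close>.\<close>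

definition mps_over :: "'a set \<Rightarrow> ('a, 'n::finite) mps set" where
  "mps_over A = {f. \<forall>\<alpha>. mps_nth f \<alpha> \<in> A}"


section \<open>Subrings, subfields and subalgebras\<close>

definition is_subring :: "'a::comm_ring_1 set \<Rightarrow> bool" where
  "is_subring A \<longleftrightarrow> 1 \<in> A \<and> (\<forall>x\<in>A. \<forall>y\<in>A. x - y \<in> A \<and> x * y \<in> A)"

definition is_subfield :: "'a::field set \<Rightarrow> bool" where
  "is_subfield A \<longleftrightarrow> is_subring A \<and> (\<forall>x\<in>A. inverse x \<in> A)"

definition is_subalgebra :: "'a::comm_ring_1 set \<Rightarrow> 'a set \<Rightarrow> bool" where
  "is_subalgebra K A \<longleftrightarrow> is_subring A \<and> K \<subseteq> A"

definition invertible_in :: "'a::comm_ring_1 set \<Rightarrow> 'a \<Rightarrow> bool" where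
  "invertible_in A x \<longleftrightarrow> x \<in> A \<and> (\<exists>y\<in>A. x * y = 1)"


section \<open>Polynomials and algebraic independence\<close>

text \<open>
  Polynomials in variables indexed by \<open>'n\<close> are finitely supported maps from
  multi-indices to coefficients.
\<close>

definition polys_over :: "'a::comm_ring_1 set \<Rightarrow> ((nat^'n::finite) \<Rightarrow>\<^sub>0 'a) set" where
  "polys_over K = {p. \<forall>\<alpha>. Poly_Mapping.lookup p \<alpha> \<in> K}"

definition poly_eval :: "'a::comm_ring_1^'n::finite \<Rightarrow> ((nat^'n) \<Rightarrow>\<^sub>0 'a) \<Rightarrow> 'a" where
  "poly_eval t p = (\<Sum>\<alpha>\<in>Poly_Mapping.keys p. Poly_Mapping.lookup p \<alpha> * (\<Prod>i\<in>UNIV. (t $ i) ^ (\<alpha> $ i)))"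

definition alg_independent :: "'a::comm_ring_1 set \<Rightarrow> 'a^'n::finite \<Rightarrow> bool" where
  "alg_independent K t \<longleftrightarrow> (\<forall>p\<in>polys_over K. poly_eval t p = 0 \<longrightarrow> p = 0)"

text \<open>The subalgebra \<open>K[t\<^sub>1,\<dots>,t\<^sub>n]\<close> and its field of fractions \<open>K(t\<^sub>1,\<dots>,t\<^sub>n)\<close>.\<close>

definition adjoin_ring :: "'a::comm_ring_1 set \<Rightarrow> 'a^'n::finite \<Rightarrow> 'a set" where
  "adjoin_ring K t = poly_eval t ` polys_over K"

definition adjoin_field :: "'a::field set \<Rightarrow> 'a^'n::finite \<Rightarrow> 'a set" where
  "adjoin_field K t = {a / b | a b. a \<in> adjoin_ring K t \<and> b \<in> adjoin_ring K t \<and> b \<noteq> 0}"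


section \<open>Separable algebraic extensions\<close>

definition is_min_poly :: "'a::field set \<Rightarrow> 'a \<Rightarrow> 'a poly \<Rightarrow> bool" where
  "is_min_poly L x p \<longleftrightarrow>
     lead_coeff p = 1 \<and> (\<forall>i. coeff p i \<in> L) \<and> poly p x = 0 \<and>
     (\<forall>q. q \<noteq> 0 \<and> (\<forall>i. coeff q i \<in> L) \<and> poly q x = 0 \<longrightarrow> degree p \<le> degree q)"

text \<open>
  An element is separable algebraic over a subfield \<open>L\<close> if it has a minimal polynomial over \<open>L\<close>
  and this is coprime to its derivative. Coprimality is taken in the polynomial ring over the
  ambient field; for polynomials over \<open>L\<close> this is the same as coprimality in \<open>L[X]\<close>, because
  the Euclidean algorithm stays in \<open>L[X]\<close>.
\<close>

definition separable_algebraic :: "'a::field set \<Rightarrow> 'a \<Rightarrow> bool" where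
  "separable_algebraic L x \<longleftrightarrow> (\<exists>p. is_min_poly L x p \<and> coprime p (pderiv p))"


section \<open>Higher derivations\<close>

definition is_ring_hom :: "'a::comm_ring_1 set \<Rightarrow> 'b::comm_ring_1 set \<Rightarrow> ('a \<Rightarrow> 'b) \<Rightarrow> bool" where
  "is_ring_hom A B f \<longleftrightarrow> f ` A \<subseteq> B \<and> f 1 = 1 \<and>
     (\<forall>x\<in>A. \<forall>y\<in>A. f (x + y) = f x + f y \<and> f (x * y) = f x * f y)"

text \<open>
  A higher derivation on a subring \<open>A\<close> of the ambient ring; only the values on \<open>A\<close> matter.
  The value \<open>\<theta>\<^sup>(\<^sup>\<alpha>\<^sup>)(r)\<close> is \<open>mps_nth (\<theta> r) \<alpha>\<close>.
\<close>

definition higher_derivation :: "'a::comm_ring_1 set \<Rightarrow> ('a \<Rightarrow> ('a, 'n::finite) mps) \<Rightarrow> bool" where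
  "higher_derivation A \<theta> \<longleftrightarrow>
     is_ring_hom A (mps_over A) \<theta> \<and> (\<forall>r\<in>A. mps_nth (\<theta> r) 0 = r)"

definition multi_binomial :: "nat^'n::finite \<Rightarrow> nat^'n \<Rightarrow> nat" where
  "multi_binomial \<alpha> \<beta> = (\<Prod>i\<in>UNIV. (\<alpha> $ i) choose (\<beta> $ i))"

definition iterative_higher_derivation ::
    "'a::comm_ring_1 set \<Rightarrow> ('a \<Rightarrow> ('a, 'n::finite) mps) \<Rightarrow> bool" where
  "iterative_higher_derivation A \<theta> \<longleftrightarrow> higher_derivation A \<theta> \<and>
     (\<forall>\<alpha> \<beta>. \<forall>r\<in>A. mps_nth (\<theta> (mps_nth (\<theta> r) \<beta>)) \<alpha> =
        of_nat (multi_binomial (\<alpha> + \<beta>) \<alpha>) * mps_nth (\<theta> r) (\<alpha> + \<beta>))"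

text \<open>
  \<open>extends_hd_wrt K t \<theta>\<close>: the restriction of \<open>\<theta>\<close> to \<open>K[t\<^sub>1,\<dots>,t\<^sub>n]\<close> is the higher derivation
  with respect to \<open>t\<close>, i.e. the \<open>K\<close>-algebra homomorphism
  \<open>K[t\<^sub>1,\<dots>,t\<^sub>n] \<rightarrow> K[t\<^sub>1,\<dots>,t\<^sub>n][[T\<^sub>1,\<dots>,T\<^sub>n]]\<close> mapping \<open>t\<^sub>i\<close> to \<open>t\<^sub>i + T\<^sub>i\<close>. As these conditions
  determine the homomorphism, it is specified by them and not introduced as a separate constant.
\<close>

definition extends_hd_wrt ::
    "'a::comm_ring_1 set \<Rightarrow> 'a^'n::finite \<Rightarrow> ('a \<Rightarrow> ('a, 'n) mps) \<Rightarrow> bool" where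
  "extends_hd_wrt K t \<theta> \<longleftrightarrow>
     is_ring_hom (adjoin_ring K t) (mps_over (adjoin_ring K t)) \<theta> \<and>
     (\<forall>c\<in>K. \<theta> c = mps_const c) \<and>
     (\<forall>i. \<theta> (t $ i) = mps_const (t $ i) + mps_var i)"

definition jacobian_matrix ::
    "('a \<Rightarrow> ('a, 'n::finite) mps) \<Rightarrow> 'a^'n \<Rightarrow> 'a^'n^'n" where
  "jacobian_matrix \<theta> t = (\<chi> i j. mps_nth (\<theta> (t $ i)) (axis j 1))"

end

theory Submission
  imports Defs
begin

text \<open>
  Existence. Write \<open>\<theta>\<^sub>s(t\<^sub>i) = t\<^sub>i + \<Sum>\<^sub>j J\<^sub>i\<^sub>j T\<^sub>j + \<dots>\<close>. Since the Jacobian is invertible over \<open>R\<close>, the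
  substitution \<open>T\<^sub>i \<mapsto> \<theta>\<^sub>s(t\<^sub>i) - t\<^sub>i\<close> is an automorphism of \<open>R[[T]]\<close>, and composing its inverse
  with \<open>\<theta>\<^sub>s\<close> gives a higher derivation with \<open>t\<^sub>i \<mapsto> t\<^sub>i + T\<^sub>i\<close>. Algebraic independence of \<open>t\<close> is read off
  from the top-degree coefficients of \<open>p(t + T)\<close>.

  Uniqueness and iterativity. Two homomorphisms on \<open>R\<close> with the same constant term that agree on \<open>K\<close>
  and \<open>t\<close> differ in lowest degree by a derivation \<open>D : R \<rightarrow> F\<close> vanishing on \<open>K\<close> and \<open>t\<close>, so one needs
  \<open>D = 0\<close>. A nonzero \<open>D\<close> would yield a nonzero derivation on \<open>R[s\<^sub>1,\<dots>,s\<^sub>n]\<close> vanishing on \<open>K\<close>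
  and \<open>t\<close>; this derivation is \<open>\<Sum>\<^sub>j D(s\<^sub>j) \<partial>/\<partial>s\<^sub>j\<close> by separability, and \<open>D(t) = J D(s) = 0\<close> forces
  \<open>D(s) = 0\<close>. In this way the separability of \<open>R\<close> over \<open>K(t)\<close> is never needed explicitly.
\<close>

section \<open>Subrings and adjunction of elements\<close>

lemma is_subring_1: "is_subring A \<Longrightarrow> 1 \<in> A"
  by (simp add: is_subring_def)

lemma is_subring_diff: "is_subring A \<Longrightarrow> x \<in> A \<Longrightarrow> y \<in> A \<Longrightarrow> x - y \<in> A"
  by (simp add: is_subring_def)

lemma is_subring_mult: "is_subring A \<Longrightarrow> x \<in> A \<Longrightarrow> y \<in> A \<Longrightarrow> x * y \<in> A"
  by (simp add: is_subring_def)

lemma is_subring_0: "is_subring A \<Longrightarrow> 0 \<in> A"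
  using is_subring_diff[of A 1 1] is_subring_1 by force

lemma is_subring_uminus: "is_subring A \<Longrightarrow> x \<in> A \<Longrightarrow> - x \<in> A"
  using is_subring_diff[of A 0 x] is_subring_0 by force

lemma is_subring_add: "is_subring A \<Longrightarrow> x \<in> A \<Longrightarrow> y \<in> A \<Longrightarrow> x + y \<in> A"
  using is_subring_diff[of A x "- y"] is_subring_uminus by force

lemma is_subring_power: "is_subring A \<Longrightarrow> x \<in> A \<Longrightarrow> x ^ k \<in> A"
  by (induction k) (auto intro: is_subring_1 is_subring_mult)

lemma is_subring_sum: "is_subring A \<Longrightarrow> (\<And>i. i \<in> I \<Longrightarrow> f i \<in> A) \<Longrightarrow> sum f I \<in> A"
  by (induction I rule: infinite_finite_induct) (auto intro: is_subring_0 is_subring_add)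

lemma is_subring_prod: "is_subring A \<Longrightarrow> (\<And>i. i \<in> I \<Longrightarrow> f i \<in> A) \<Longrightarrow> prod f I \<in> A"
  by (induction I rule: infinite_finite_induct) (auto intro: is_subring_1 is_subring_mult)

lemma is_subring_of_nat: "is_subring A \<Longrightarrow> of_nat k \<in> A"
  by (induction k) (auto intro: is_subring_0 is_subring_1 is_subring_add)

lemmas is_subring_closed = is_subring_0 is_subring_1 is_subring_add is_subring_diff
  is_subring_uminus is_subring_mult is_subring_power is_subring_sum is_subring_prod
  is_subring_of_nat

lemma is_subring_det:
  fixes M :: "'a::comm_ring_1^'n::finite^'n"
  assumes "is_subring A" "\<And>i j. M $ i $ j \<in> A"
  shows "det M \<in> A"
proof -
  have "of_int (sign \<pi>) \<in> A" for \<pi> :: "'n \<Rightarrow> 'n"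
    using assms by (simp add: sign_def is_subring_closed)
  then show ?thesis
    unfolding det_def using assms by (intro is_subring_sum is_subring_mult is_subring_prod) auto
qed

section \<open>Monomials and the subring \<open>K[t]\<close>\<close>

definition monomial_eval :: "'a::comm_ring_1^'n::finite \<Rightarrow> nat^'n \<Rightarrow> 'a" where
  "monomial_eval t \<alpha> = (\<Prod>i\<in>UNIV. (t $ i) ^ (\<alpha> $ i))"

lemma monomial_eval_0 [simp]: "monomial_eval t 0 = 1"
  by (simp add: monomial_eval_def)

lemma monomial_eval_add: "monomial_eval t (\<alpha> + \<beta>) = monomial_eval t \<alpha> * monomial_eval t \<beta>"
  by (simp add: monomial_eval_def power_add prod.distrib)

lemma monomial_eval_axis [simp]: "monomial_eval t (axis i k) = (t $ i) ^ k"
proof -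
  have "monomial_eval t (axis i k) = (\<Prod>j\<in>UNIV. if j = i then (t $ i) ^ k else 1)"
    unfolding monomial_eval_def by (rule prod.cong) (auto simp: axis_def)
  then show ?thesis by simp
qed

lemma poly_eval_eq_sum:
  assumes "finite S" "Poly_Mapping.keys p \<subseteq> S"
  shows "poly_eval t p = (\<Sum>\<alpha>\<in>S. Poly_Mapping.lookup p \<alpha> * monomial_eval t \<alpha>)"
  unfolding poly_eval_def monomial_eval_def using assms
  by (intro sum.mono_neutral_left) (auto simp: in_keys_iff)

lemma adjoin_ring_subset:
  assumes "is_subring A" "K \<subseteq> A" "\<And>i. t $ i \<in> A"
  shows "adjoin_ring K t \<subseteq> A"
  using assms unfolding adjoin_ring_def poly_eval_def polys_over_def
  by (auto intro!: is_subring_sum is_subring_mult is_subring_prod is_subring_power)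

lemma adjoin_ring_monomial:
  assumes "is_subring K" "c \<in> K"
  shows "c * monomial_eval t \<alpha> \<in> adjoin_ring K t"
proof -
  have "Poly_Mapping.single \<alpha> c \<in> polys_over K"
    using assms by (auto simp: polys_over_def lookup_single when_def is_subring_0)
  moreover have "poly_eval t (Poly_Mapping.single \<alpha> c) = c * monomial_eval t \<alpha>"
    by (subst poly_eval_eq_sum[of "{\<alpha>}"]) auto
  ultimately show ?thesis unfolding adjoin_ring_def by (metis imageI)
qed

lemma adjoin_ring_diff:
  assumes "is_subring K" "x \<in> adjoin_ring K t" "y \<in> adjoin_ring K t"
  shows "x - y \<in> adjoin_ring K t"
proof -
  obtain p q where pq: "p \<in> polys_over K" "x = poly_eval t p" "q \<in> polys_over K" "y = poly_eval t q"
    using assms by (auto simp: adjoin_ring_def)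
  let ?S = "Poly_Mapping.keys p \<union> Poly_Mapping.keys q"
  have "poly_eval t (p - q) = x - y"
    using pq keys_diff[of p q]
    by (simp add: poly_eval_eq_sum[of ?S] lookup_minus left_diff_distrib sum_subtractf)
  moreover have "p - q \<in> polys_over K"
    using pq assms by (auto simp: polys_over_def lookup_minus intro: is_subring_diff)
  ultimately show ?thesis unfolding adjoin_ring_def by (metis imageI)
qed

lemma is_subring_adjoin_ring:
  assumes K: "is_subring K"
  shows "is_subring (adjoin_ring K t)"
proof -
  have 0: "0 \<in> adjoin_ring K t"
    using adjoin_ring_monomial[OF K is_subring_0[OF K], of t 0] by simp
  have add: "x + y \<in> adjoin_ring K t" if "x \<in> adjoin_ring K t" "y \<in> adjoin_ring K t" for x y
    using adjoin_ring_diff[OF K that(1) adjoin_ring_diff[OF K 0 that(2)]] by simp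
  have sum: "sum f I \<in> adjoin_ring K t" if "\<And>i. i \<in> I \<Longrightarrow> f i \<in> adjoin_ring K t"
    for f and I :: "(nat^'b) set"
    using that by (induction I rule: infinite_finite_induct) (auto intro: 0 add)
  have "poly_eval t p * poly_eval t q \<in> adjoin_ring K t"
    if "p \<in> polys_over K" "q \<in> polys_over K" for p q
  proof -
    have "poly_eval t p * poly_eval t q = (\<Sum>\<alpha>\<in>Poly_Mapping.keys p. \<Sum>\<beta>\<in>Poly_Mapping.keys q.
        (Poly_Mapping.lookup p \<alpha> * Poly_Mapping.lookup q \<beta>) * monomial_eval t (\<alpha> + \<beta>))"
      by (simp add: poly_eval_eq_sum[OF finite_keys subset_refl] sum_product monomial_eval_add mult_ac)
    also have "\<dots> \<in> adjoin_ring K t"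
      using that K by (intro sum adjoin_ring_monomial) (auto simp: polys_over_def intro: is_subring_mult)
    finally show ?thesis .
  qed
  then show ?thesis
    using adjoin_ring_diff[OF K, of _ t] adjoin_ring_monomial[OF K is_subring_1[OF K], of t 0]
    unfolding is_subring_def adjoin_ring_def by auto
qed

lemma adjoin_ring_base: "is_subring K \<Longrightarrow> K \<subseteq> adjoin_ring K t"
  using adjoin_ring_monomial[of K _ t 0] by auto

lemma adjoin_ring_var: "is_subring K \<Longrightarrow> t $ i \<in> adjoin_ring K t"
  using adjoin_ring_monomial[of K 1 t "axis i 1"] by (simp add: is_subring_1)


section \<open>Derivations\<close>

text \<open>The target is viewed as a module over \<open>A\<close> through \<open>\<phi>\<close>.
  The identity gives ordinary derivations, and \<theta> itself gives the derivations into power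
  series that arise for iterativity. Linearity over \<open>K\<close> is expressed separately, by
  vanishing on \<open>K\<close>.\<close>

definition deriv_along :: "('a::comm_ring_1 \<Rightarrow> 'b::comm_ring_1) \<Rightarrow> 'a set \<Rightarrow> ('a \<Rightarrow> 'b) \<Rightarrow> bool" where
  "deriv_along \<phi> A D \<longleftrightarrow>
     (\<forall>x\<in>A. \<forall>y\<in>A. D (x + y) = D x + D y \<and> D (x * y) = \<phi> x * D y + \<phi> y * D x)"

lemma deriv_along_add: "deriv_along \<phi> A D \<Longrightarrow> x \<in> A \<Longrightarrow> y \<in> A \<Longrightarrow> D (x + y) = D x + D y"
  by (simp add: deriv_along_def)

lemma deriv_along_mult:
  "deriv_along \<phi> A D \<Longrightarrow> x \<in> A \<Longrightarrow> y \<in> A \<Longrightarrow> D (x * y) = \<phi> x * D y + \<phi> y * D x"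
  by (simp add: deriv_along_def)

lemma deriv_along_0: "is_subring A \<Longrightarrow> deriv_along \<phi> A D \<Longrightarrow> D 0 = 0"
  using deriv_along_add[of \<phi> A D 0 0] is_subring_0 by force

lemma deriv_along_id_1: "is_subring A \<Longrightarrow> deriv_along (\<lambda>x. x) A D \<Longrightarrow> D 1 = 0"
  using deriv_along_mult[of "\<lambda>x. x" A D 1 1] is_subring_1 by force

lemma deriv_along_diff:
  assumes "is_subring A" "deriv_along \<phi> A D" "x \<in> A" "y \<in> A"
  shows "D (x - y) = D x - D y"
  using deriv_along_add[OF assms(2), of "x - y" y] assms by (simp add: is_subring_diff)

lemma deriv_along_sum:
  assumes "is_subring A" "deriv_along \<phi> A D" "\<And>i. i \<in> I \<Longrightarrow> f i \<in> A"
  shows "D (sum f I) = (\<Sum>i\<in>I. D (f i))"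
  using assms(3)
  by (induction I rule: infinite_finite_induct)
     (auto simp: deriv_along_0[OF assms(1,2)] deriv_along_add[OF assms(2)] is_subring_sum[OF assms(1)])

lemma is_subring_deriv_kernel:
  assumes "is_subring A" "deriv_along (\<lambda>x. x) A D"
  shows "is_subring {x \<in> A. D x = 0}"
  unfolding is_subring_def using assms
  by (auto simp: is_subring_closed deriv_along_diff[OF assms] deriv_along_mult[OF assms(2)]
      deriv_along_id_1[OF assms])

section \<open>Extension of a derivation to a simple ring extension\<close>

definition polys_in :: "'a::comm_ring_1 set \<Rightarrow> 'a poly set" where
  "polys_in A = {f. \<forall>i. coeff f i \<in> A}"

lemma polys_in_coeff: "f \<in> polys_in A \<Longrightarrow> coeff f i \<in> A"
  by (simp add: polys_in_def)

lemma polys_in_arith: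
  assumes "is_subring A" "f \<in> polys_in A" "g \<in> polys_in A"
  shows "f + g \<in> polys_in A" "f - g \<in> polys_in A" "f * g \<in> polys_in A"
  using assms by (auto simp: polys_in_def coeff_mult intro!: is_subring_closed)

lemma polys_in_simple:
  assumes "is_subring A" "a \<in> A"
  shows "monom a k \<in> polys_in A" "[:a:] \<in> polys_in A" "[:0, 1:] \<in> polys_in A"
  using assms by (auto simp: polys_in_def is_subring_closed coeff_pCons split: nat.splits)

text \<open>The value that sum and product rule force on \<open>f(y)\<close> for every extension of
  \<open>D\<close> sending \<open>y\<close> to \<open>d\<close>.\<close>

definition poly_deriv :: "('a::idom \<Rightarrow> 'a) \<Rightarrow> 'a \<Rightarrow> 'a \<Rightarrow> 'a poly \<Rightarrow> 'a" where
  "poly_deriv D y d f = poly (map_poly D f) y + poly (pderiv f) y * d"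

context
  fixes A :: "'a::idom set" and D :: "'a \<Rightarrow> 'a"
  assumes A: "is_subring A" and D: "deriv_along (\<lambda>x. x) A D"
begin

lemma poly_deriv_add:
  assumes "f \<in> polys_in A" "g \<in> polys_in A"
  shows "poly_deriv D y d (f + g) = poly_deriv D y d f + poly_deriv D y d g"
proof -
  have "map_poly D (f + g) = map_poly D f + map_poly D g"
    using assms by (intro poly_eqI)
      (simp add: coeff_map_poly deriv_along_0[OF A D] deriv_along_add[OF D] polys_in_coeff)
  then show ?thesis by (simp add: poly_deriv_def pderiv_add algebra_simps)
qed

lemma poly_deriv_diff:
  assumes "f \<in> polys_in A" "g \<in> polys_in A"
  shows "poly_deriv D y d (f - g) = poly_deriv D y d f - poly_deriv D y d g"
  using poly_deriv_add[of "f - g" g] assms polys_in_arith[OF A] by simp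

lemma poly_deriv_mult:
  assumes "f \<in> polys_in A" "g \<in> polys_in A"
  shows "poly_deriv D y d (f * g) = poly f y * poly_deriv D y d g + poly g y * poly_deriv D y d f"
proof -
  have "map_poly D (f * g) = f * map_poly D g + g * map_poly D f"
  proof (rule poly_eqI)
    fix n
    have "coeff (map_poly D (f * g)) n = D (\<Sum>i\<le>n. coeff f i * coeff g (n - i))"
      by (simp add: coeff_map_poly deriv_along_0[OF A D] coeff_mult)
    also have "\<dots> = (\<Sum>i\<le>n. D (coeff f i * coeff g (n - i)))"
      using assms by (intro deriv_along_sum[OF A D] is_subring_mult[OF A] polys_in_coeff)
    also have "\<dots> = (\<Sum>i\<le>n. coeff f i * D (coeff g (n - i))) + (\<Sum>i\<le>n. D (coeff f i) * coeff g (n - i))"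
      using assms by (simp add: deriv_along_mult[OF D] polys_in_coeff sum.distrib mult.commute)
    also have "\<dots> = coeff (f * map_poly D g + map_poly D f * g) n"
      by (simp add: coeff_mult coeff_map_poly deriv_along_0[OF A D])
    finally show "coeff (map_poly D (f * g)) n = coeff (f * map_poly D g + g * map_poly D f) n"
      by (simp add: mult.commute)
  qed
  then show ?thesis by (simp add: poly_deriv_def pderiv_mult algebra_simps)
qed

lemma poly_deriv_const: "poly_deriv D y d [:a:] = D a"
  by (simp add: poly_deriv_def map_poly_pCons deriv_along_0[OF A D])

lemma poly_deriv_var: "poly_deriv D y d [:0, 1:] = d"
  using deriv_along_0[OF A D] deriv_along_id_1[OF A D]
  by (simp add: poly_deriv_def map_poly_pCons pderiv_pCons)

text \<open>Every element of \<open>A[y]\<close> is some \<open>f(y)\<close>, so the forced value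
  defines the extension once it depends on \<open>f(y)\<close> only. By additivity this is the
  condition on polynomials vanishing at \<open>y\<close>.\<close>

lemma deriv_extend_simple:
  assumes wd: "\<And>f. f \<in> polys_in A \<Longrightarrow> poly f y = 0 \<Longrightarrow> poly_deriv D y d f = 0"
  obtains A' D' where "is_subring A'" "deriv_along (\<lambda>x. x) A' D'" "A \<subseteq> A'" "y \<in> A'"
    "\<And>x. x \<in> A \<Longrightarrow> D' x = D x" "D' y = d"
proof -
  define A' where "A' = (\<lambda>f. poly f y) ` polys_in A"
  \<comment> \<open>The choice of the representing polynomial is immaterial: two choices differ by a
    polynomial vanishing at \<open>y\<close>, to which \<open>wd\<close> applies.\<close>
  define D' where "D' z = poly_deriv D y d (SOME f. f \<in> polys_in A \<and> poly f y = z)" for z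
  have D': "D' (poly f y) = poly_deriv D y d f" if f: "f \<in> polys_in A" for f
  proof -
    let ?g = "SOME g. g \<in> polys_in A \<and> poly g y = poly f y"
    have g: "?g \<in> polys_in A \<and> poly ?g y = poly f y"
      by (rule someI[of _ f]) (simp add: f)
    then have "poly_deriv D y d (?g - f) = 0"
      by (intro wd polys_in_arith A f) auto
    then show ?thesis using g f by (simp add: D'_def poly_deriv_diff)
  qed
  note ar = polys_in_arith[OF A] polys_in_simple[OF A]
  show ?thesis
  proof
    show "is_subring A'"
      unfolding is_subring_def A'_def
    proof (intro conjI ballI)
      show "1 \<in> (\<lambda>f. poly f y) ` polys_in A"
        by (rule image_eqI[of _ _ "[:1:]"]) (auto intro: ar is_subring_1[OF A])
      fix u v assume "u \<in> (\<lambda>f. poly f y) ` polys_in A" "v \<in> (\<lambda>f. poly f y) ` polys_in A"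
      then obtain f g where fg: "f \<in> polys_in A" "g \<in> polys_in A" "u = poly f y" "v = poly g y" by auto
      show "u - v \<in> (\<lambda>f. poly f y) ` polys_in A"
        by (rule image_eqI[of _ _ "f - g"]) (auto simp: fg intro: ar)
      show "u * v \<in> (\<lambda>f. poly f y) ` polys_in A"
        by (rule image_eqI[of _ _ "f * g"]) (auto simp: fg intro: ar)
    qed
    show "deriv_along (\<lambda>x. x) A' D'"
      unfolding deriv_along_def
    proof (intro ballI)
      fix u v assume "u \<in> A'" "v \<in> A'"
      then obtain f g where fg: "f \<in> polys_in A" "g \<in> polys_in A" "u = poly f y" "v = poly g y"
        by (auto simp: A'_def)
      show "D' (u + v) = D' u + D' v \<and> D' (u * v) = u * D' v + v * D' u"
        using D'[OF ar(1)[OF fg(1,2)]] D'[OF ar(3)[OF fg(1,2)]] fg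
        by (simp add: D' poly_deriv_add poly_deriv_mult)
    qed
    show "D' x = D x" if "x \<in> A" for x
      using D'[OF ar(5)[OF that]] by (simp add: poly_deriv_const)
    show "A \<subseteq> A'"
    proof
      fix x assume "x \<in> A"
      then show "x \<in> A'"
        unfolding A'_def by (intro image_eqI[of _ _ "[:x:]"]) (auto intro: ar)
    qed
    show "y \<in> A'"
      unfolding A'_def by (rule image_eqI[of _ _ "[:0, 1:]"]) (auto intro: ar is_subring_1[OF A])
    show "D' y = d"
      using D'[OF ar(6)[OF is_subring_1[OF A]]] by (simp add: poly_deriv_var)
  qed
qed

end

text \<open>Pseudo-division by an annihilating polynomial of minimal degree.\<close>

lemma poly_deriv_annihilates:
  fixes A :: "'a::idom set"
  assumes A: "is_subring A" and D: "deriv_along (\<lambda>x. x) A D"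
    and p: "p \<in> polys_in A" "p \<noteq> 0" "poly p y = 0" "poly_deriv D y d p = 0"
    and min: "\<And>q. q \<in> polys_in A \<Longrightarrow> q \<noteq> 0 \<Longrightarrow> poly q y = 0 \<Longrightarrow> degree p \<le> degree q"
    and f: "f \<in> polys_in A" "poly f y = 0"
  shows "poly_deriv D y d f = 0"
  using f
proof (induction "degree f" arbitrary: f rule: less_induct)
  case less
  note ar = polys_in_arith[OF A] polys_in_simple[OF A]
  show ?case
  proof (cases "f = 0")
    case True
    then show ?thesis by (simp add: poly_deriv_def)
  next
    case False
    define c where "c = lead_coeff p"
    define m where "m = monom (lead_coeff f) (degree f - degree p)"
    \<comment> \<open>\<open>A\<close> need not be a field, so \<open>f\<close> is first multiplied
      by the leading coefficient \<open>c\<close> of \<open>p\<close>; the leading terms then cancel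
      without division.\<close>
    define h where "h = [:c:] * f - m * p"
    have cm: "[:c:] \<in> polys_in A" "m \<in> polys_in A"
      unfolding c_def m_def using p less.prems by (auto intro!: ar polys_in_coeff)
    have deg: "degree p \<le> degree f" using min less.prems False by blast
    have cf: "[:c:] * f \<in> polys_in A" and mp: "m * p \<in> polys_in A"
      using ar(3)[OF cm(1) less.prems(1)] ar(3)[OF cm(2) p(1)] .
    have h: "h \<in> polys_in A" "poly h y = 0"
      using ar(2)[OF cf mp] p less.prems by (simp_all add: h_def)
    have "poly_deriv D y d h = 0"
    proof (cases "h = 0")
      case True
      then show ?thesis by (simp add: poly_deriv_def)
    next
      case hnz: False
      have "degree (m * p) \<le> degree f"
        unfolding m_def using deg
        by (intro order.trans[OF degree_mult_le]) (use degree_monom_le[of "lead_coeff f" "degree f - degree p"] in linarith)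
      moreover have "degree ([:c:] * f) \<le> degree f"
        by (intro order.trans[OF degree_mult_le]) simp
      ultimately have le: "degree h \<le> degree f"
        unfolding h_def by (intro degree_diff_le)
      have "coeff (m * p) (degree f) = lead_coeff f * c"
        unfolding m_def c_def using deg by (simp add: coeff_monom_mult)
      then have "coeff h (degree f) = 0"
        by (simp add: h_def)
      then have "degree h < degree f"
        using le hnz by (metis le_neq_implies_less leading_coeff_0_iff)
      then show ?thesis using less.hyps h by blast
    qed
    \<comment> \<open>All other terms of the product rule contain \<open>f(y)\<close>,
      \<open>p(y)\<close> or \<open>poly_deriv D y d p\<close>, which are zero. Since
      \<open>c\<close> is nonzero in a domain, it can be cancelled afterwards.\<close>
    moreover have "poly_deriv D y d h = c * poly_deriv D y d f"
      unfolding h_def using poly_deriv_diff[OF A D cf mp] poly_deriv_mult[OF A D cm(1) less.prems(1)]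
        poly_deriv_mult[OF A D cm(2) p(1)] p less.prems
      by (simp del: mult_pCons_left)
    ultimately show ?thesis using p by (simp add: c_def)
  qed
qed

lemma poly_deriv_0: "poly_deriv (\<lambda>_. 0) y 1 (f :: 'a::idom poly) = poly (pderiv f) y"
proof -
  have "map_poly (\<lambda>_. 0) f = (0 :: 'a::idom poly)" by (rule poly_eqI) (simp add: coeff_map_poly)
  then show ?thesis by (simp only: poly_deriv_def) simp
qed

lemma deriv_along_zero: "deriv_along \<phi> A (\<lambda>_. 0)"
  by (simp add: deriv_along_def)

text \<open>
  If \<open>y\<close> is a simple root of a polynomial over \<open>A\<close>, then the derivation extends to \<open>A[y]\<close>.
  Otherwise \<open>f(y) = 0\<close> implies \<open>f'(y) = 0\<close>, so that the formal derivative in \<open>y\<close>, which vanishes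
  on \<open>A\<close>, is a well-defined derivation on \<open>A[y]\<close>. No case distinction on the
  characteristic or on algebraicity is necessary.
\<close>

lemma nonzero_deriv_adjoin:
  fixes A :: "'a::field set"
  assumes A: "is_subring A" and D: "deriv_along (\<lambda>x. x) A D"
    and C: "C \<subseteq> A" "\<And>x. x \<in> C \<Longrightarrow> D x = 0" and nz: "x0 \<in> A" "D x0 \<noteq> 0"
  obtains A' D' x' where "is_subring A'" "deriv_along (\<lambda>x. x) A' D'" "A \<subseteq> A'" "y \<in> A'"
    "\<And>x. x \<in> C \<Longrightarrow> D' x = 0" "x' \<in> A'" "D' x' \<noteq> 0"
proof (cases "\<forall>f\<in>polys_in A. poly f y = 0 \<longrightarrow> poly (pderiv f) y = 0")
  case True
  have "poly_deriv (\<lambda>_. 0) y 1 f = 0" if "f \<in> polys_in A" "poly f y = 0" for f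
    using True that by (simp add: poly_deriv_0)
  from deriv_extend_simple[OF A deriv_along_zero this] obtain A' D' where
    "is_subring A'" "deriv_along (\<lambda>x. x) A' D'" "A \<subseteq> A'" "y \<in> A'"
    "\<And>x. x \<in> A \<Longrightarrow> D' x = 0" "D' y = 1" by blast
  then show ?thesis using that[of A' D' y] C by auto
next
  case False
  then obtain f where f: "f \<in> polys_in A" "poly f y = 0" "poly (pderiv f) y \<noteq> 0" by auto
  define P where "P q \<longleftrightarrow> q \<in> polys_in A \<and> q \<noteq> 0 \<and> poly q y = 0" for q
  have "P f" using f by (auto simp: P_def)
  then obtain p where p: "P p" and min: "\<And>q. P q \<Longrightarrow> degree p \<le> degree q"
    using ex_has_least_nat[of P f degree] by blast
  \<comment> \<open>Otherwise the zero derivation on \<open>A\<close>, with \<open>y\<close> sent to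
    1, would give 0 on every annihilating polynomial, in particular
    \<open>f'(y) = 0\<close>.\<close>
  have "poly (pderiv p) y \<noteq> 0"
  proof
    assume "poly (pderiv p) y = 0"
    then have "poly_deriv (\<lambda>_. 0) y 1 f = 0"
      using p min f
      by - (rule poly_deriv_annihilates[OF A deriv_along_zero, of p], simp_all add: poly_deriv_0 P_def)
    then show False using f by (simp add: poly_deriv_0)
  qed
  \<comment> \<open>The value for \<open>y\<close> is the solution \<open>d\<close> of the linear
    equation \<open>poly_deriv D y d p = 0\<close>.\<close>
  then have "poly_deriv D y (- poly (map_poly D p) y / poly (pderiv p) y) p = 0"
    by (simp add: poly_deriv_def)
  then have wd: "poly_deriv D y (- poly (map_poly D p) y / poly (pderiv p) y) q = 0"
    if "q \<in> polys_in A" "poly q y = 0" for q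
    using p min that by - (rule poly_deriv_annihilates[OF A D, of p], simp_all add: P_def)
  obtain A' D' where
    *: "is_subring A'" "deriv_along (\<lambda>x. x) A' D'" "A \<subseteq> A'" "y \<in> A'"
    and eq: "\<And>x. x \<in> A \<Longrightarrow> D' x = D x"
    by (rule deriv_extend_simple[OF A D wd]; (rule that; assumption)?)
  show ?thesis
  proof (rule that[OF *])
    show "D' x = 0" if "x \<in> C" for x
      using that C by (subst eq) auto
    show "x0 \<in> A'" using nz * by blast
    show "D' x0 \<noteq> 0" using nz by (subst eq)
  qed
qed

text \<open>The derivation obtained at a stage need not extend the previous one, as it may be a
  formal derivative in the new element. Only vanishing on \<open>C\<close> and being nonzero
  somewhere are inherited, so the witness \<open>x'\<close> may change.\<close>

lemma nonzero_deriv_adjoin_finite: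
  fixes A :: "'a::field set"
  assumes "finite Y" and A: "is_subring A" "deriv_along (\<lambda>x. x) A D"
    and C: "C \<subseteq> A" "\<And>x. x \<in> C \<Longrightarrow> D x = 0" and nz: "x0 \<in> A" "D x0 \<noteq> 0"
  shows "\<exists>A' D' x'. is_subring A' \<and> deriv_along (\<lambda>x. x) A' D' \<and> A \<subseteq> A' \<and> Y \<subseteq> A' \<and>
    (\<forall>x\<in>C. D' x = 0) \<and> x' \<in> A' \<and> D' x' \<noteq> 0"
  using assms(1)
proof (induction Y)
  case empty
  then show ?case using assms by blast
next
  case (insert y Y)
  then obtain A' D' x' where *: "is_subring A'" "deriv_along (\<lambda>x. x) A' D'" "A \<subseteq> A'" "Y \<subseteq> A'"
    "\<And>x. x \<in> C \<Longrightarrow> D' x = 0" "x' \<in> A'" "D' x' \<noteq> 0" by blast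
  obtain A'' D'' x'' where "is_subring A''" "deriv_along (\<lambda>x. x) A'' D''" "A' \<subseteq> A''" "y \<in> A''"
    "\<And>x. x \<in> C \<Longrightarrow> D'' x = 0" "x'' \<in> A''" "D'' x'' \<noteq> 0"
    by (rule nonzero_deriv_adjoin[OF *(1,2) _ *(5-7), where y = y]) (use * C in auto)
  then show ?case using * by (intro exI[of _ A''] exI[of _ D''] exI[of _ x'']) auto
qed

section \<open>Separable algebraic elements\<close>

lemma adjoin_field_common_denominator:
  assumes K: "is_subring K" and "finite I" "\<And>i. i \<in> I \<Longrightarrow> f i \<in> adjoin_field K s"
  shows "\<exists>b\<in>adjoin_ring K s. b \<noteq> 0 \<and> (\<forall>i\<in>I. b * f i \<in> adjoin_ring K s)"
  using assms(2,3)
proof (induction I)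
  case empty
  then show ?case using is_subring_1[OF is_subring_adjoin_ring[OF K, of s]] by (intro bexI[of _ 1]) auto
next
  case (insert i I)
  then obtain b where b: "b \<in> adjoin_ring K s" "b \<noteq> 0" "\<And>i. i \<in> I \<Longrightarrow> b * f i \<in> adjoin_ring K s"
    by force
  obtain u v where uv: "f i = u / v" "u \<in> adjoin_ring K s" "v \<in> adjoin_ring K s" "v \<noteq> 0"
    using insert.prems[of i] by (auto simp: adjoin_field_def)
  note mult = is_subring_mult[OF is_subring_adjoin_ring[OF K], of _ s]
  have "v * b * f j \<in> adjoin_ring K s" if "j \<in> insert i I" for j
  proof (cases "j = i")
    case True
    then have "v * b * f j = b * u" using uv by simp
    then show ?thesis using mult[OF b(1) uv(2)] by (simp only:)
  next
    case False
    then show ?thesis using mult[OF uv(3) b(3)[of j]] that by (simp add: mult.assoc)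
  qed
  then show ?case using mult[OF uv(3) b(1)] b uv by (intro bexI[of _ "v * b"]) auto
qed

text \<open>Applying \<open>D\<close> to a relation \<open>q(x) = 0\<close> whose coefficients lie
  in \<open>K[s]\<close>, hence are killed by \<open>D\<close>, leaves
  \<open>q'(x) * D x = 0\<close>. Separability makes \<open>q'(x)\<close> nonzero.\<close>

lemma deriv_vanishes_separable:
  fixes A :: "'a::field set"
  assumes K: "is_subring K" "K \<subseteq> A" and A: "is_subring A" and D: "deriv_along (\<lambda>x. x) A D"
    and s: "\<And>i. s $ i \<in> A" "\<And>i. D (s $ i) = 0" and DK: "\<And>c. c \<in> K \<Longrightarrow> D c = 0"
    and x: "x \<in> A" and sep: "separable_algebraic (adjoin_field K s) x"
  shows "D x = 0"
proof -
  have ker: "adjoin_ring K s \<subseteq> {x \<in> A. D x = 0}"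
    using assms by (intro adjoin_ring_subset is_subring_deriv_kernel) auto
  obtain p where p: "is_min_poly (adjoin_field K s) x p" "coprime p (pderiv p)"
    using sep by (auto simp: separable_algebraic_def)
  have px: "poly p x = 0" using p by (simp add: is_min_poly_def)
  \<comment> \<open>A common root of \<open>p\<close> and its derivative would give them the common
    factor \<open>X - x\<close>.\<close>
  have p'x: "poly (pderiv p) x \<noteq> 0"
  proof
    assume "poly (pderiv p) x = 0"
    then have "is_unit [:-x, 1:]"
      using px p(2) by (meson coprime_common_divisor poly_eq_0_iff_dvd)
    then show False by (simp add: is_unit_iff_degree)
  qed
  \<comment> \<open>\<open>D\<close> is available only on the ring \<open>A\<close>, so the
    coefficients of \<open>p\<close>, which are fractions, are moved into \<open>K[s]\<close> by a
    common denominator.\<close>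
  obtain b where b: "b \<in> adjoin_ring K s" "b \<noteq> 0"
      "\<And>i. i \<le> degree p \<Longrightarrow> b * coeff p i \<in> adjoin_ring K s"
    using adjoin_field_common_denominator[OF K(1), of "{..degree p}" "coeff p" s] p
    by (auto simp: is_min_poly_def)
  define q where "q = smult b p"
  have q: "coeff q i \<in> adjoin_ring K s" for i
    using b(3)[of i] is_subring_0[OF is_subring_adjoin_ring[OF K(1), of s]]
    by (cases "i \<le> degree p") (auto simp: q_def coeff_eq_0)
  have D0: "map_poly D q = 0"
    using q ker by (intro poly_eqI) (auto simp: coeff_map_poly deriv_along_0[OF A D])
  have q_in: "q \<in> polys_in A" using q ker by (auto simp: polys_in_def)
  \<comment> \<open>As \<open>D\<close> is already defined at \<open>x\<close>, the forced value on
    \<open>f(x)\<close> is the actual one.\<close>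
  have *: "poly_deriv D x (D x) f = D (poly f x)" if "f \<in> polys_in A" for f
    using that
  proof (induction f)
    case 0
    then show ?case using deriv_along_0[OF A D] by (simp add: poly_deriv_def)
  next
    case (pCons a f)
    have a: "a \<in> A" using polys_in_coeff[OF pCons.prems, of 0] by simp
    have f: "f \<in> polys_in A"
      unfolding polys_in_def using polys_in_coeff[OF pCons.prems, of "Suc _"] by simp
    have fx: "poly f x \<in> A"
      unfolding poly_altdef using A f x by (intro is_subring_sum is_subring_mult is_subring_power polys_in_coeff)
    have X: "[:0, 1:] \<in> polys_in A" using polys_in_simple(3)[OF A a] .
    have "pCons a f = [:a:] + [:0, 1:] * f" by simp
    also have "poly_deriv D x (D x) \<dots> = D a + (x * D (poly f x) + poly f x * D x)"
      using pCons.IH[OF f] poly_deriv_mult[OF A D X f] f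
      by (subst poly_deriv_add[OF A D polys_in_simple(2)[OF A a] polys_in_arith(3)[OF A X f]])
         (simp add: poly_deriv_const[OF A D] poly_deriv_var[OF A D] del: mult_pCons_left)
    also have "\<dots> = D (poly (pCons a f) x)"
      using a x fx by (simp add: deriv_along_add[OF D] deriv_along_mult[OF D] is_subring_mult[OF A])
    finally show ?case .
  qed
  have "poly (pderiv q) x * D x = 0"
    using *[OF q_in] px deriv_along_0[OF A D] D0 by (simp add: poly_deriv_def q_def)
  then show ?thesis using p'x b by (simp add: q_def pderiv_smult)
qed

section \<open>Arithmetic of power series\<close>

lemma mps_nth_0 [simp]: "mps_nth 0 \<alpha> = 0"
  by (simp add: zero_mps.rep_eq)

lemma mps_nth_1: "mps_nth 1 \<alpha> = (if \<alpha> = 0 then 1 else 0)"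
  by (simp add: one_mps.rep_eq)

lemma mps_nth_add [simp]: "mps_nth (f + g) \<alpha> = mps_nth f \<alpha> + mps_nth g \<alpha>"
  by (simp add: plus_mps.rep_eq)

lemma mps_nth_diff [simp]: "mps_nth (f - g) \<alpha> = mps_nth f \<alpha> - mps_nth g \<alpha>"
  by (simp add: minus_mps.rep_eq)

lemma mps_nth_mult:
  "mps_nth (f * g) \<alpha> = (\<Sum>(\<beta>, \<gamma>)\<in>index_splits \<alpha>. mps_nth f \<beta> * mps_nth g \<gamma>)"
  by (simp add: times_mps.rep_eq)

lemma mps_nth_const: "mps_nth (mps_const c) \<alpha> = (if \<alpha> = 0 then c else 0)"
  by (simp add: mps_const.rep_eq)

lemma mps_nth_var: "mps_nth (mps_var i) \<alpha> = (if \<alpha> = axis i 1 then 1 else 0)"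
  by (simp add: mps_var.rep_eq)

lemma mps_nth_sum: "mps_nth (sum f I) \<alpha> = (\<Sum>i\<in>I. mps_nth (f i) \<alpha>)"
  by (induction I rule: infinite_finite_induct) auto

lemma multiindex_add_eq_0 [simp]: "\<alpha> + \<beta> = 0 \<longleftrightarrow> \<alpha> = 0 \<and> \<beta> = (0 :: nat^'n::finite)"
  by (auto simp: vec_eq_iff)

lemma axis_1_neq_0 [simp]: "axis i (1::nat) \<noteq> 0" "axis i (Suc 0) \<noteq> 0"
  by (auto simp: axis_eq_0_iff)

lemma mps_nth_mult_0 [simp]: "mps_nth (f * g) 0 = mps_nth f 0 * mps_nth g 0"
  by (simp add: mps_nth_mult)

lemma mps_nth_mult_const [simp]: "mps_nth (mps_const c * f) \<alpha> = c * mps_nth f \<alpha>"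
proof -
  have "mps_nth (mps_const c * f) \<alpha> =
      (\<Sum>p\<in>index_splits \<alpha>. if p = (0, \<alpha>) then c * mps_nth f \<alpha> else 0)"
    unfolding mps_nth_mult by (intro sum.cong) (auto simp: mps_nth_const split: if_split_asm)
  then show ?thesis by simp
qed

lemma mps_const_1 [simp]: "mps_const 1 = 1"
  by (rule mps_eqI) (simp add: mps_nth_const mps_nth_1)

lemma mps_const_mult: "mps_const (c * d) = mps_const c * mps_const d"
  by (rule mps_eqI) (simp add: mps_nth_const)

lemma is_subring_mps_over:
  assumes A: "is_subring A"
  shows "is_subring (mps_over A :: ('a::comm_ring_1, 'b::finite) mps set)"
  unfolding is_subring_def mps_over_def
proof (intro conjI ballI CollectI allI)
  show "mps_nth 1 \<alpha> \<in> A" for \<alpha>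
    using A by (simp add: mps_nth_1 is_subring_closed)
  fix f g :: "('a, 'b) mps" and \<alpha> assume "f \<in> {f. \<forall>\<alpha>. mps_nth f \<alpha> \<in> A}" "g \<in> {f. \<forall>\<alpha>. mps_nth f \<alpha> \<in> A}"
  then show "mps_nth (f - g) \<alpha> \<in> A" "mps_nth (f * g) \<alpha> \<in> A"
    using A by (auto simp: mps_nth_mult is_subring_diff intro!: is_subring_sum is_subring_mult)
qed

lemma mps_over_const: "is_subring A \<Longrightarrow> c \<in> A \<Longrightarrow> mps_const c \<in> mps_over A"
  by (auto simp: mps_over_def mps_nth_const is_subring_0)

lemma mps_over_var: "is_subring A \<Longrightarrow> mps_var i \<in> mps_over A"
  by (auto simp: mps_over_def mps_nth_var is_subring_0 is_subring_1)

lemma mps_over_nth: "f \<in> mps_over A \<Longrightarrow> mps_nth f \<alpha> \<in> A"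
  by (simp add: mps_over_def)

section \<open>Total degree of multi-indices\<close>

definition total_degree :: "nat^'n::finite \<Rightarrow> nat" where
  "total_degree \<alpha> = (\<Sum>i\<in>UNIV. \<alpha> $ i)"

lemma total_degree_add [simp]: "total_degree (\<alpha> + \<beta>) = total_degree \<alpha> + total_degree \<beta>"
  by (simp add: total_degree_def sum.distrib)

lemma total_degree_eq_0 [simp]: "total_degree \<alpha> = 0 \<longleftrightarrow> \<alpha> = 0"
  by (simp add: total_degree_def vec_eq_iff)

lemma total_degree_pos [simp]: "total_degree \<alpha> > 0 \<longleftrightarrow> \<alpha> \<noteq> 0"
  using total_degree_eq_0[of \<alpha>] by linarith

lemma total_degree_0 [simp]: "total_degree 0 = 0"
  by simp

lemma total_degree_axis [simp]: "total_degree (axis i k) = k"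
proof -
  have "total_degree (axis i k) = (\<Sum>j\<in>UNIV. if j = i then k else 0)"
    unfolding total_degree_def by (rule sum.cong) (auto simp: axis_def)
  then show ?thesis by simp
qed

lemma finite_total_degree_le [simp]: "finite {\<alpha> :: nat^'n::finite. total_degree \<alpha> \<le> N}"
proof (rule finite_subset)
  show "{\<alpha> :: nat^'n. total_degree \<alpha> \<le> N} \<subseteq> {\<alpha>. \<forall>i. \<alpha> $ i \<le> (\<chi> i. N) $ i}"
  proof clarify
    fix \<alpha> :: "nat^'n" and i assume "total_degree \<alpha> \<le> N"
    moreover have "\<alpha> $ i \<le> total_degree \<alpha>"
      unfolding total_degree_def by (rule member_le_sum) auto
    ultimately show "\<alpha> $ i \<le> (\<chi> i. N) $ i" by simp
  qed
qed (rule finite_atMost_multiindex)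

lemma finite_total_degree_less [simp]: "finite {\<alpha> :: nat^'n::finite. total_degree \<alpha> < N}"
  by (rule finite_subset[OF _ finite_total_degree_le[of N]]) auto

lemma total_degree_le_1:
  "{\<alpha> :: nat^'n::finite. total_degree \<alpha> \<le> 1} = insert 0 (range (\<lambda>i. axis i 1))"
proof (intro set_eqI iffI)
  fix \<alpha> :: "nat^'n" assume "\<alpha> \<in> {\<alpha>. total_degree \<alpha> \<le> 1}"
  then have *: "sum (($) \<alpha>) UNIV \<le> 1" by (simp add: total_degree_def)
  show "\<alpha> \<in> insert 0 (range (\<lambda>i. axis i 1))"
  proof (cases "\<alpha> = 0")
    case False
    then obtain i where i: "\<alpha> $ i \<noteq> 0" by (auto simp: vec_eq_iff)
    have "sum (($) \<alpha>) UNIV = \<alpha> $ i + sum (($) \<alpha>) (UNIV - {i})"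
      by (rule sum.remove) auto
    then have "\<alpha> $ i = 1" "sum (($) \<alpha>) (UNIV - {i}) = 0" using * i by linarith+
    then have "\<alpha> = axis i 1" by (simp add: vec_eq_iff axis_def)
    then show ?thesis by auto
  qed simp
qed auto


section \<open>Ring homomorphisms into power series\<close>

lemma is_ring_hom_mono: "is_ring_hom A B \<theta> \<Longrightarrow> B \<subseteq> B' \<Longrightarrow> is_ring_hom A B' \<theta>"
  by (auto simp: is_ring_hom_def)

lemma is_ring_hom_0: "is_ring_hom A B f \<Longrightarrow> is_subring A \<Longrightarrow> f 0 = 0"
  unfolding is_ring_hom_def using is_subring_0[of A] by (metis add_cancel_right_left)

lemma is_ring_hom_diff:
  assumes "is_ring_hom A B f" "is_subring A" "x \<in> A" "y \<in> A"
  shows "f (x - y) = f x - f y"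
proof -
  have "f (x - y + y) = f (x - y) + f y"
    using assms is_subring_diff[OF assms(2-4)] unfolding is_ring_hom_def by blast
  then show ?thesis by simp
qed

lemma is_ring_hom_power:
  assumes "is_ring_hom A B f" "is_subring A" "x \<in> A"
  shows "f (x ^ k) = f x ^ k"
  using assms is_subring_power[OF assms(2,3)] by (induction k) (auto simp: is_ring_hom_def)

lemma is_ring_hom_sum:
  assumes "is_ring_hom A B f" "is_subring A" "\<And>i. i \<in> I \<Longrightarrow> g i \<in> A"
  shows "f (sum g I) = (\<Sum>i\<in>I. f (g i))"
  using assms(3)
proof (induction I rule: infinite_finite_induct)
  case (insert i I)
  then have "sum g I \<in> A" "g i \<in> A" using is_subring_sum[OF assms(2), of I g] by auto
  then show ?case using insert assms(1) by (simp add: is_ring_hom_def)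
qed (auto simp: is_ring_hom_0[OF assms(1,2)])

lemma is_ring_hom_prod:
  assumes "is_ring_hom A B f" "is_subring A" "\<And>i. i \<in> I \<Longrightarrow> g i \<in> A"
  shows "f (prod g I) = (\<Prod>i\<in>I. f (g i))"
  using assms(3)
proof (induction I rule: infinite_finite_induct)
  case (insert i I)
  then have "prod g I \<in> A" "g i \<in> A" using is_subring_prod[OF assms(2), of I g] by auto
  then show ?case using insert assms(1) by (simp add: is_ring_hom_def)
qed (use assms(1) in \<open>auto simp: is_ring_hom_def\<close>)

text \<open>
  The difference of two homomorphisms with the same constant term is, in the lowest degree in which
  they differ, a derivation.
\<close>

lemma ring_hom_mps_eqI:
  fixes f g :: "'a::comm_ring_1 \<Rightarrow> ('b::comm_ring_1, 'n::finite) mps"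
  assumes f: "is_ring_hom A UNIV f" and g: "is_ring_hom A UNIV g"
    and f0: "\<And>x. x \<in> A \<Longrightarrow> mps_nth (f x) 0 = \<phi> x" and g0: "\<And>x. x \<in> A \<Longrightarrow> mps_nth (g x) 0 = \<phi> x"
    and C: "\<And>x. x \<in> C \<Longrightarrow> f x = g x"
    and rigid: "\<And>D. deriv_along \<phi> A D \<Longrightarrow> (\<And>x. x \<in> C \<Longrightarrow> D x = 0) \<Longrightarrow> (\<And>x. x \<in> A \<Longrightarrow> D x = 0)"
    and x: "x \<in> A"
  shows "f x = g x"
proof -
  have "\<forall>x\<in>A. mps_nth (f x) \<alpha> = mps_nth (g x) \<alpha>" for \<alpha>
  proof (induction "total_degree \<alpha>" arbitrary: \<alpha> rule: less_induct)
    case less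
    show ?case
    proof (cases "\<alpha> = 0")
      case True
      then show ?thesis by (simp add: f0 g0)
    next
      case \<alpha>: False
      define D where "D x = mps_nth (f x) \<alpha> - mps_nth (g x) \<alpha>" for x
      have "deriv_along \<phi> A D"
        unfolding deriv_along_def
      proof (intro ballI conjI)
        fix x y assume xy: "x \<in> A" "y \<in> A"
        show "D (x + y) = D x + D y"
          using f g xy by (simp add: D_def is_ring_hom_def)
        have "D (x * y) = (\<Sum>(\<beta>, \<gamma>)\<in>index_splits \<alpha>.
            mps_nth (f x) \<beta> * mps_nth (f y) \<gamma> - mps_nth (g x) \<beta> * mps_nth (g y) \<gamma>)"
          using f g xy by (simp add: D_def is_ring_hom_def mps_nth_mult sum_subtractf case_prod_unfold)
        \<comment> \<open>In a split with two nonzero parts both have smaller total degree, where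
          \<open>f\<close> and \<open>g\<close> agree by induction; only the extreme splits
          remain.\<close>
        also have "\<dots> = (\<Sum>p\<in>index_splits \<alpha>.
            (if p = (0, \<alpha>) then \<phi> x * D y else 0) + (if p = (\<alpha>, 0) then \<phi> y * D x else 0))"
        proof (intro sum.cong refl, clarify)
          fix \<beta> \<gamma> assume "(\<beta>, \<gamma>) \<in> index_splits \<alpha>"
          then have \<beta>\<gamma>: "\<beta> + \<gamma> = \<alpha>" by simp
          show "mps_nth (f x) \<beta> * mps_nth (f y) \<gamma> - mps_nth (g x) \<beta> * mps_nth (g y) \<gamma> =
              (if (\<beta>, \<gamma>) = (0, \<alpha>) then \<phi> x * D y else 0) + (if (\<beta>, \<gamma>) = (\<alpha>, 0) then \<phi> y * D x else 0)"
          proof (cases "\<beta> = 0 \<or> \<gamma> = 0")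
            case True
            then show ?thesis
              using \<beta>\<gamma> \<alpha> xy by (auto simp: D_def f0 g0 algebra_simps)
          next
            case False
            then have "total_degree \<beta> < total_degree \<alpha>" "total_degree \<gamma> < total_degree \<alpha>"
              using \<beta>\<gamma> by auto
            then show ?thesis using less.hyps xy False by auto
          qed
        qed
        also have "\<dots> = \<phi> x * D y + \<phi> y * D x"
          by (simp add: sum.distrib)
        finally show "D (x * y) = \<phi> x * D y + \<phi> y * D x" .
      qed
      moreover have "D x = 0" if "x \<in> C" for x using C that by (simp add: D_def)
      ultimately have "D x = 0" if "x \<in> A" for x using rigid that by blast
      then show ?thesis by (simp add: D_def)
    qed
  qed
  then show ?thesis using x by (intro mps_eqI) auto
qed

text \<open>Rigidity passes from ordinary derivations to derivations along \<open>\<phi>\<close>.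
  Once the coefficients of \<open>D\<close> in lower degree vanish, only the constant term
  \<open>x\<close> of \<open>\<phi> x\<close> contributes to the coefficient of
  \<open>\<phi> x * D y\<close> at \<alpha>, so that coefficient of \<open>D\<close> is an ordinary
  derivation.\<close>

lemma rigid_along_mps:
  fixes \<phi> :: "'a::comm_ring_1 \<Rightarrow> ('a, 'n::finite) mps"
  assumes \<phi>0: "\<And>x. x \<in> A \<Longrightarrow> mps_nth (\<phi> x) 0 = x"
    and rigid: "\<And>D. deriv_along (\<lambda>x. x) A D \<Longrightarrow> (\<And>x. x \<in> C \<Longrightarrow> D x = 0) \<Longrightarrow> (\<And>x. x \<in> A \<Longrightarrow> D x = (0::'a))"
    and D: "deriv_along \<phi> A D" and C: "\<And>x. x \<in> C \<Longrightarrow> D x = 0" and x: "x \<in> A"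
  shows "D x = 0"
proof -
  have "\<forall>x\<in>A. mps_nth (D x) \<alpha> = 0" for \<alpha>
  proof (induction "total_degree \<alpha>" arbitrary: \<alpha> rule: less_induct)
    case less
    have *: "mps_nth (\<phi> x * D y) \<alpha> = x * mps_nth (D y) \<alpha>" if "x \<in> A" "y \<in> A" for x y
    proof -
      have "mps_nth (\<phi> x * D y) \<alpha> =
          (\<Sum>p\<in>index_splits \<alpha>. if p = (0, \<alpha>) then x * mps_nth (D y) \<alpha> else 0)"
        unfolding mps_nth_mult
      proof (intro sum.cong refl, clarify)
        fix \<beta> \<gamma> assume "(\<beta>, \<gamma>) \<in> index_splits \<alpha>"
        then have \<beta>\<gamma>: "\<beta> + \<gamma> = \<alpha>" by simp
        show "mps_nth (\<phi> x) \<beta> * mps_nth (D y) \<gamma> =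
            (if (\<beta>, \<gamma>) = (0, \<alpha>) then x * mps_nth (D y) \<alpha> else 0)"
        proof (cases "\<beta> = 0")
          case True
          then show ?thesis using \<beta>\<gamma> that by (simp add: \<phi>0)
        next
          case False
          then have "total_degree \<gamma> < total_degree \<alpha>" using \<beta>\<gamma> by auto
          then show ?thesis using less.hyps that False by simp
        qed
      qed
      then show ?thesis by simp
    qed
    have "deriv_along (\<lambda>x. x) A (\<lambda>x. mps_nth (D x) \<alpha>)"
      unfolding deriv_along_def
      using * by (simp add: deriv_along_add[OF D] deriv_along_mult[OF D])
    then show ?case using rigid[of "\<lambda>x. mps_nth (D x) \<alpha>"] C by auto
  qed
  then show ?thesis using x by (intro mps_eqI) auto
qed

section \<open>Substitution of power series\<close>

definition mps_monomial :: "('n::finite \<Rightarrow> ('a::comm_ring_1, 'm::finite) mps) \<Rightarrow> nat^'n \<Rightarrow> ('a, 'm) mps" where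
  "mps_monomial g \<alpha> = (\<Prod>i\<in>UNIV. g i ^ (\<alpha> $ i))"

lemma mps_monomial_eq: "mps_monomial g \<alpha> = monomial_eval (\<chi> i. g i) \<alpha>"
  by (simp add: mps_monomial_def monomial_eval_def)

lemma mps_monomial_0 [simp]: "mps_monomial g 0 = 1"
  by (simp add: mps_monomial_eq)

lemma mps_monomial_add: "mps_monomial g (\<alpha> + \<beta>) = mps_monomial g \<alpha> * mps_monomial g \<beta>"
  by (simp add: mps_monomial_eq monomial_eval_add)

lemma mps_monomial_axis: "mps_monomial g (axis i k) = g i ^ k"
  by (simp add: mps_monomial_eq)

lemma mps_monomial_in:
  "is_subring B \<Longrightarrow> (\<And>i. g i \<in> B) \<Longrightarrow> mps_monomial g \<alpha> \<in> B"
  unfolding mps_monomial_def by (intro is_subring_prod is_subring_power)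

section \<open>Order of a power series and substitution\<close>

definition order_ge :: "nat \<Rightarrow> ('a::comm_ring_1, 'n::finite) mps \<Rightarrow> bool" where
  "order_ge k f \<longleftrightarrow> (\<forall>\<gamma>. total_degree \<gamma> < k \<longrightarrow> mps_nth f \<gamma> = 0)"

lemma order_ge_mult:
  fixes f g :: "('a::comm_ring_1, 'n::finite) mps"
  assumes "order_ge k f" "order_ge l g"
  shows "order_ge (k + l) (f * g)"
  unfolding order_ge_def mps_nth_mult
proof (intro allI impI sum.neutral, clarify)
  fix \<gamma> \<beta> \<delta> :: "nat^'n" assume "total_degree \<gamma> < k + l" "(\<beta>, \<delta>) \<in> index_splits \<gamma>"
  then have "total_degree \<beta> < k \<or> total_degree \<delta> < l" by auto
  then show "mps_nth f \<beta> * mps_nth g \<delta> = 0"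
    using assms by (auto simp: order_ge_def)
qed

lemma order_ge_power: "order_ge 1 f \<Longrightarrow> order_ge k (f ^ k)"
proof (induction k)
  case (Suc k)
  then show ?case using order_ge_mult[of 1 f k "f ^ k"] by simp
qed (simp add: order_ge_def)

lemma order_ge_prod:
  "finite I \<Longrightarrow> (\<And>i. i \<in> I \<Longrightarrow> order_ge (k i) (f i)) \<Longrightarrow> order_ge (sum k I) (prod f I)"
proof (induction I rule: finite_induct)
  case (insert i I)
  then show ?case using order_ge_mult[of "k i" "f i" "sum k I" "prod f I"] by simp
qed (simp add: order_ge_def)

lemma order_ge_monomial:
  assumes "\<And>i. mps_nth (g i) 0 = 0"
  shows "order_ge (total_degree \<alpha>) (mps_monomial g \<alpha>)"
  unfolding mps_monomial_def total_degree_def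
  using assms by (intro order_ge_prod order_ge_power) (auto simp: order_ge_def)

text \<open>For \<open>g\<close> without constant terms the monomial of index \<alpha> starts in
  degree at least |\<alpha>|. The omitted indices then contribute nothing, and the finite sum is the
  usual infinite one.\<close>

definition mps_subst ::
    "('n::finite \<Rightarrow> ('a::comm_ring_1, 'm::finite) mps) \<Rightarrow> ('a, 'n) mps \<Rightarrow> ('a, 'm) mps" where
  "mps_subst g c = Abs_mps (\<lambda>\<gamma>. \<Sum>\<alpha> | total_degree \<alpha> \<le> total_degree \<gamma>.
     mps_nth c \<alpha> * mps_nth (mps_monomial g \<alpha>) \<gamma>)"

lemma mps_nth_subst_eq:
  "mps_nth (mps_subst g c) \<gamma> =
    (\<Sum>\<alpha> | total_degree \<alpha> \<le> total_degree \<gamma>. mps_nth c \<alpha> * mps_nth (mps_monomial g \<alpha>) \<gamma>)"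
  by (simp add: mps_subst_def Abs_mps_inverse)

context
  fixes g :: "'n::finite \<Rightarrow> ('a::comm_ring_1, 'm::finite) mps"
  assumes g0: "\<And>i. mps_nth (g i) 0 = 0"
begin

lemma mps_monomial_nth_0: "total_degree \<gamma> < total_degree \<alpha> \<Longrightarrow> mps_nth (mps_monomial g \<alpha>) \<gamma> = 0"
  using order_ge_monomial[of g \<alpha>] g0 by (auto simp: order_ge_def)

text \<open>With one bound \<open>N\<close> for many coefficients, they can all be read off the same
  finite sum, which can be multiplied out in the ring.\<close>

lemma mps_nth_subst:
  assumes "total_degree \<gamma> \<le> N"
  shows "mps_nth (mps_subst g c) \<gamma> =
    mps_nth (\<Sum>\<alpha> | total_degree \<alpha> \<le> N. mps_const (mps_nth c \<alpha>) * mps_monomial g \<alpha>) \<gamma>"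
  unfolding mps_nth_subst_eq mps_nth_sum mps_nth_mult_const using assms
  by (intro sum.mono_neutral_left) (auto simp: mps_monomial_nth_0)

lemma mps_subst_add: "mps_subst g (c + d) = mps_subst g c + mps_subst g d"
  by (rule mps_eqI) (simp add: mps_nth_subst_eq sum.distrib distrib_right)

lemma mps_subst_mult: "mps_subst g (c * d) = mps_subst g c * mps_subst g d"
proof (rule mps_eqI)
  fix \<gamma> :: "nat^'m"
  define N where "N = total_degree \<gamma>"
  define S where "S = {\<alpha> :: nat^'n. total_degree \<alpha> \<le> N}"
  have S: "finite S" by (simp add: S_def)
  let ?c = "mps_nth c" and ?d = "mps_nth d"
  let ?P = "\<lambda>c. \<Sum>\<alpha>\<in>S. mps_const (mps_nth c \<alpha>) * mps_monomial g \<alpha>"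
  let ?t = "\<lambda>(\<alpha>, \<beta>). ?c \<alpha> * ?d \<beta> * mps_nth (mps_monomial g (\<alpha> + \<beta>)) \<gamma>"
  have "mps_nth (mps_subst g c * mps_subst g d) \<gamma> = mps_nth (?P c * ?P d) \<gamma>"
    unfolding mps_nth_mult
  proof (intro sum.cong refl, clarify)
    fix \<beta> \<delta> :: "nat^'m" assume "(\<beta>, \<delta>) \<in> index_splits \<gamma>"
    then have "total_degree \<beta> \<le> N" "total_degree \<delta> \<le> N" by (auto simp: N_def)
    then show "mps_nth (mps_subst g c) \<beta> * mps_nth (mps_subst g d) \<delta> =
        mps_nth (?P c) \<beta> * mps_nth (?P d) \<delta>"
      unfolding S_def by (simp only: mps_nth_subst)
  qed
  also have "?P c * ?P d = (\<Sum>(\<alpha>, \<beta>)\<in>S \<times> S. mps_const (?c \<alpha> * ?d \<beta>) * mps_monomial g (\<alpha> + \<beta>))"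
    by (simp add: sum_product sum.cartesian_product mps_const_mult mps_monomial_add mult_ac)
  also have "mps_nth \<dots> \<gamma> = (\<Sum>p\<in>S \<times> S. ?t p)"
    by (simp add: mps_nth_sum case_prod_unfold)
  \<comment> \<open>Pairs whose sum has degree above \<open>N\<close> contribute nothing at
    \<gamma>. The others are grouped by their sum \<delta>, which produces the coefficients of
    \<open>c * d\<close>.\<close>
  also have "\<dots> = (\<Sum>p\<in>(\<Union>\<delta>\<in>S. index_splits \<delta>). ?t p)"
    using S by (intro sum.mono_neutral_right)
      (auto simp: S_def N_def not_le mps_monomial_nth_0)
  also have "\<dots> = (\<Sum>\<delta>\<in>S. \<Sum>p\<in>index_splits \<delta>. ?t p)"
    using S by (intro sum.UNION_disjoint) auto
  also have "\<dots> = (\<Sum>\<delta>\<in>S. mps_nth (c * d) \<delta> * mps_nth (mps_monomial g \<delta>) \<gamma>)"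
    by (auto simp: mps_nth_mult sum_distrib_right intro!: sum.cong)
  also have "\<dots> = mps_nth (?P (c * d)) \<gamma>"
    by (simp add: mps_nth_sum)
  also have "\<dots> = mps_nth (mps_subst g (c * d)) \<gamma>"
    unfolding S_def by (rule mps_nth_subst[symmetric]) (simp add: N_def)
  finally show "mps_nth (mps_subst g (c * d)) \<gamma> = mps_nth (mps_subst g c * mps_subst g d) \<gamma>" by simp
qed

lemma mps_subst_const: "mps_subst g (mps_const a) = mps_const a"
proof (rule mps_eqI)
  fix \<gamma> :: "nat^'m"
  have "mps_nth (mps_subst g (mps_const a)) \<gamma> =
      (\<Sum>\<alpha>\<in>{\<alpha> :: nat^'n. total_degree \<alpha> \<le> total_degree \<gamma>}. if \<alpha> = 0 then a * mps_nth 1 \<gamma> else 0)"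
    unfolding mps_nth_subst_eq by (rule sum.cong) (auto simp: mps_nth_const)
  then show "mps_nth (mps_subst g (mps_const a)) \<gamma> = mps_nth (mps_const a) \<gamma>"
    by (simp add: mps_nth_const mps_nth_1)
qed

lemma mps_subst_var: "mps_subst g (mps_var i) = g i"
proof (rule mps_eqI)
  fix \<gamma> :: "nat^'m"
  \<comment> \<open>The bound is raised by one so that the index \<open>axis i 1\<close> is in range
    even for \<gamma> = 0.\<close>
  have "mps_nth (mps_subst g (mps_var i)) \<gamma> =
      (\<Sum>\<alpha> | total_degree \<alpha> \<le> Suc (total_degree \<gamma>). if \<alpha> = axis i 1 then mps_nth (g i) \<gamma> else 0)"
    unfolding mps_nth_subst[OF le_SucI[OF order_refl]] mps_nth_sum mps_nth_mult_const
    by (rule sum.cong) (auto simp: mps_nth_var mps_monomial_axis)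
  then show "mps_nth (mps_subst g (mps_var i)) \<gamma> = mps_nth (g i) \<gamma>"
    by simp
qed

lemma mps_nth_subst_0: "mps_nth (mps_subst g c) 0 = mps_nth c 0"
  by (simp add: mps_nth_subst_eq mps_nth_1)

text \<open>The chain rule for linear parts: indices of degree at least 2 are out of range, and the
  index 0 contributes the linear coefficient of 1, which is 0.\<close>

lemma mps_nth_subst_axis:
  "mps_nth (mps_subst g c) (axis k 1) = (\<Sum>j\<in>UNIV. mps_nth c (axis j 1) * mps_nth (g j) (axis k 1))"
proof -
  have inj: "inj (\<lambda>i::'n. axis i (1::nat))"
    by (auto simp: inj_on_def axis_eq_axis)
  have "mps_nth (mps_subst g c) (axis k 1) = 
    (\<Sum>\<alpha>\<in>insert 0 (range (\<lambda>i. axis i 1)). mps_nth c \<alpha> * mps_nth (mps_monomial g \<alpha>) (axis k 1))"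
    unfolding mps_nth_subst_eq total_degree_axis total_degree_le_1 ..
  also have "\<dots> = (\<Sum>\<alpha>\<in>range (\<lambda>i. axis i 1). mps_nth c \<alpha> * mps_nth (mps_monomial g \<alpha>) (axis k 1))"
    by (subst sum.insert) (auto simp: mps_nth_1)
  also have "\<dots> = (\<Sum>j\<in>UNIV. mps_nth c (axis j 1) * mps_nth (g j) (axis k 1))"
    by (subst sum.reindex[OF inj]) (simp add: mps_monomial_axis)
  finally show ?thesis .
qed

lemma mps_subst_over:
  assumes "is_subring A" "\<And>i. g i \<in> mps_over A" "c \<in> mps_over A"
  shows "mps_subst g c \<in> mps_over A"
proof -
  have "mps_monomial g \<alpha> \<in> mps_over A" for \<alpha>
    using assms by (intro mps_monomial_in is_subring_mps_over)
  then show ?thesis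
    using assms by (auto simp: mps_over_def mps_nth_subst_eq intro!: is_subring_sum is_subring_mult)
qed

end

text \<open>
  \<open>dominant_monomial 1\<close> says that \<open>T\<^sup>\<alpha>\<close> is the only term of total degree at most \<open>|\<alpha>|\<close>, and
  \<open>dominant_monomial (-1)\<close> that it is the only term of total degree at least \<open>|\<alpha>|\<close>.
\<close>

definition dominant_monomial :: "int \<Rightarrow> nat^'n::finite \<Rightarrow> ('a::comm_ring_1, 'n) mps \<Rightarrow> bool" where
  "dominant_monomial \<sigma> \<alpha> f \<longleftrightarrow>
     (\<forall>\<gamma>. \<sigma> * int (total_degree \<gamma>) \<le> \<sigma> * int (total_degree \<alpha>) \<longrightarrow>
       mps_nth f \<gamma> = (if \<gamma> = \<alpha> then 1 else 0))"

lemma dominant_monomial_mult: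
  fixes f g :: "('a::comm_ring_1, 'n::finite) mps"
  assumes f: "dominant_monomial \<sigma> \<alpha> f" and g: "dominant_monomial \<sigma> \<beta> g"
  shows "dominant_monomial \<sigma> (\<alpha> + \<beta>) (f * g)"
  unfolding dominant_monomial_def
proof (intro allI impI)
  fix \<gamma> :: "nat^'n" assume le: "\<sigma> * int (total_degree \<gamma>) \<le> \<sigma> * int (total_degree (\<alpha> + \<beta>))"
  have "mps_nth (f * g) \<gamma> = (\<Sum>p\<in>index_splits \<gamma>. if p = (\<alpha>, \<beta>) then 1 else 0)"
    unfolding mps_nth_mult
  proof (intro sum.cong refl, clarify)
    fix \<delta> \<epsilon> :: "nat^'n" assume "(\<delta>, \<epsilon>) \<in> index_splits \<gamma>"
    then have "\<sigma> * int (total_degree \<delta>) + \<sigma> * int (total_degree \<epsilon>) \<le>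
        \<sigma> * int (total_degree \<alpha>) + \<sigma> * int (total_degree \<beta>)"
      using le by (auto simp flip: distrib_left)
    \<comment> \<open>Either both parts respect their bounds, or one is strictly on the small side;
      its factor vanishes there, because the index differs from the dominant one.\<close>
    then consider
        "\<sigma> * int (total_degree \<delta>) \<le> \<sigma> * int (total_degree \<alpha>)" "\<sigma> * int (total_degree \<epsilon>) \<le> \<sigma> * int (total_degree \<beta>)"
      | "\<sigma> * int (total_degree \<delta>) < \<sigma> * int (total_degree \<alpha>)"
      | "\<sigma> * int (total_degree \<epsilon>) < \<sigma> * int (total_degree \<beta>)"
      by linarith
    then show "mps_nth f \<delta> * mps_nth g \<epsilon> = (if (\<delta>, \<epsilon>) = (\<alpha>, \<beta>) then 1 else 0)"
    proof cases
      case 1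
      then show ?thesis using f g by (auto simp: dominant_monomial_def)
    next
      case 2
      then have "\<delta> \<noteq> \<alpha>" by auto
      then show ?thesis using f 2 by (auto simp: dominant_monomial_def)
    next
      case 3
      then have "\<epsilon> \<noteq> \<beta>" by auto
      then show ?thesis using g 3 by (auto simp: dominant_monomial_def)
    qed
  qed
  then show "mps_nth (f * g) \<gamma> = (if \<gamma> = \<alpha> + \<beta> then 1 else 0)"
    by auto
qed

lemma dominant_monomial_1: "\<sigma> = 1 \<or> \<sigma> = -1 \<Longrightarrow> dominant_monomial \<sigma> 0 1"
  by (auto simp: dominant_monomial_def mps_nth_1)

lemma dominant_monomial_power:
  fixes f :: "('a::comm_ring_1, 'n::finite) mps"
  assumes "\<sigma> = 1 \<or> \<sigma> = -1" "dominant_monomial \<sigma> (axis i 1) f"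
  shows "dominant_monomial \<sigma> (axis i k) (f ^ k)"
proof (induction k)
  case 0
  have "axis i 0 = (0 :: nat^'n)" by (simp add: vec_eq_iff axis_def)
  then show ?case using dominant_monomial_1[OF assms(1)] by (simp only: power_0)
next
  case (Suc k)
  have "axis i (Suc k) = axis i 1 + (axis i k :: nat^'n)" by (simp add: vec_eq_iff axis_def)
  then show ?case using dominant_monomial_mult[OF assms(2) Suc] by (simp only: power_Suc)
qed

lemma dominant_monomial_monomial:
  fixes g :: "'n::finite \<Rightarrow> ('a::comm_ring_1, 'n) mps"
  assumes \<sigma>: "\<sigma> = 1 \<or> \<sigma> = -1" and g: "\<And>i. dominant_monomial \<sigma> (axis i 1) (g i)"
  shows "dominant_monomial \<sigma> \<alpha> (mps_monomial g \<alpha>)"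
proof -
  have "dominant_monomial \<sigma> (\<Sum>i\<in>I. axis i (\<alpha> $ i)) (\<Prod>i\<in>I. g i ^ (\<alpha> $ i))" if "finite I" for I
    using that
    by induction (auto intro!: dominant_monomial_mult dominant_monomial_power \<sigma> g dominant_monomial_1)
  from this[OF finite] have "dominant_monomial \<sigma> (\<Sum>i\<in>UNIV. axis i (\<alpha> $ i)) (mps_monomial g \<alpha>)"
    by (simp add: mps_monomial_def)
  moreover have "(\<Sum>i\<in>UNIV. axis i (\<alpha> $ i)) = \<alpha>"
    by (simp add: vec_eq_iff axis_def)
  ultimately show ?thesis by simp
qed

text \<open>
  Substitution of a series with dominant monomials is unitriangular with respect to the total degree,
  so preimages are determined by recursion.
\<close>

function subst_preimage ::
    "('n::finite \<Rightarrow> ('a::comm_ring_1, 'n) mps) \<Rightarrow> ('a, 'n) mps \<Rightarrow> nat^'n \<Rightarrow> 'a" where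
  "subst_preimage g f \<gamma> = mps_nth f \<gamma> -
     (\<Sum>\<alpha> | total_degree \<alpha> < total_degree \<gamma>. subst_preimage g f \<alpha> * mps_nth (mps_monomial g \<alpha>) \<gamma>)"
  by pat_completeness auto
termination by (relation "Wellfounded.measure (\<lambda>(g, f, \<gamma>). total_degree \<gamma>)") auto

declare subst_preimage.simps [simp del]

context
  fixes g :: "'n::finite \<Rightarrow> ('a::comm_ring_1, 'n) mps"
  assumes g: "\<And>i. dominant_monomial 1 (axis i 1) (g i)"
begin

text \<open>Among the monomials of the same degree as \<gamma>, dominance leaves only the one of
  index \<gamma>, with coefficient 1.\<close>

lemma mps_nth_subst_triangular:
  "mps_nth (mps_subst g c) \<gamma> = mps_nth c \<gamma> +
     (\<Sum>\<alpha> | total_degree \<alpha> < total_degree \<gamma>. mps_nth c \<alpha> * mps_nth (mps_monomial g \<alpha>) \<gamma>)"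
proof -
  have dom: "mps_nth (mps_monomial g \<alpha>) \<gamma> = (if \<gamma> = \<alpha> then 1 else 0)" if "total_degree \<gamma> = total_degree \<alpha>" for \<alpha>
    using dominant_monomial_monomial[of 1 g \<alpha>] g that by (auto simp: dominant_monomial_def)
  have "{\<alpha> :: nat^'n. total_degree \<alpha> \<le> total_degree \<gamma>} =
      {\<alpha>. total_degree \<alpha> < total_degree \<gamma>} \<union> {\<alpha>. total_degree \<alpha> = total_degree \<gamma>}" by auto
  moreover have fin: "finite {\<alpha> :: nat^'n. total_degree \<alpha> = total_degree \<gamma>}"
    by (rule finite_subset[OF _ finite_total_degree_le[of "total_degree \<gamma>"]]) auto
  ultimately have "mps_nth (mps_subst g c) \<gamma> =
      (\<Sum>\<alpha> | total_degree \<alpha> < total_degree \<gamma>. mps_nth c \<alpha> * mps_nth (mps_monomial g \<alpha>) \<gamma>) +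
      (\<Sum>\<alpha> | total_degree \<alpha> = total_degree \<gamma>. mps_nth c \<alpha> * mps_nth (mps_monomial g \<alpha>) \<gamma>)"
    unfolding mps_nth_subst_eq by (simp only:) (subst sum.union_disjoint, auto)
  also have "(\<Sum>\<alpha> | total_degree \<alpha> = total_degree \<gamma>. mps_nth c \<alpha> * mps_nth (mps_monomial g \<alpha>) \<gamma>) =
      (\<Sum>\<alpha> | total_degree \<alpha> = total_degree \<gamma>. if \<alpha> = \<gamma> then mps_nth c \<gamma> else 0)"
    by (rule sum.cong) (auto simp: dom)
  also have "\<dots> = mps_nth c \<gamma>" using fin by simp
  finally show ?thesis by simp
qed

lemma mps_subst_eqD:
  assumes "mps_subst g c = mps_subst g d"
  shows "c = d"
proof (rule mps_eqI)
  show "mps_nth c \<gamma> = mps_nth d \<gamma>" for \<gamma>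
  proof (induction "total_degree \<gamma>" arbitrary: \<gamma> rule: less_induct)
    case less
    have "(\<Sum>\<alpha> | total_degree \<alpha> < total_degree \<gamma>. mps_nth c \<alpha> * mps_nth (mps_monomial g \<alpha>) \<gamma>) =
        (\<Sum>\<alpha> | total_degree \<alpha> < total_degree \<gamma>. mps_nth d \<alpha> * mps_nth (mps_monomial g \<alpha>) \<gamma>)"
      by (rule sum.cong) (auto simp: less)
    then show ?case
      using arg_cong[OF assms, of "\<lambda>f. mps_nth f \<gamma>"] by (simp add: mps_nth_subst_triangular)
  qed
qed

lemma mps_subst_preimage: "mps_subst g (Abs_mps (subst_preimage g f)) = f"
proof (rule mps_eqI)
  show "mps_nth (mps_subst g (Abs_mps (subst_preimage g f))) \<gamma> = mps_nth f \<gamma>" for \<gamma>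
    using subst_preimage.simps[of g f \<gamma>] by (simp add: mps_nth_subst_triangular Abs_mps_inverse)
qed

text \<open>The diagonal entries are 1, so the recursion involves no division and stays in
  \<open>A\<close>.\<close>

lemma subst_preimage_over:
  assumes A: "is_subring A" and g_in: "\<And>i. g i \<in> mps_over A" and f: "f \<in> mps_over A"
  shows "Abs_mps (subst_preimage g f) \<in> mps_over A"
proof -
  have m: "mps_nth (mps_monomial g \<alpha>) \<gamma> \<in> A" for \<alpha> \<gamma>
    using mps_monomial_in[OF is_subring_mps_over[OF A] g_in] by (rule mps_over_nth)
  have "subst_preimage g f \<gamma> \<in> A" for \<gamma>
  proof (induction "total_degree \<gamma>" arbitrary: \<gamma> rule: less_induct)
    case less
    then show ?case
      using f by (subst subst_preimage.simps)
        (auto intro!: is_subring_diff[OF A] is_subring_sum[OF A] is_subring_mult[OF A] m mps_over_nth)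
  qed
  then show ?thesis by (simp add: mps_over_def Abs_mps_inverse)
qed

end

section \<open>Derivations vanishing on elements with invertible Jacobian\<close>

lemma multiindex_add_eq_axis:
  "\<alpha> + \<beta> = axis i 1 \<longleftrightarrow> \<alpha> = 0 \<and> \<beta> = axis i (1::nat) \<or> \<alpha> = axis i 1 \<and> \<beta> = 0"
proof
  assume *: "\<alpha> + \<beta> = axis i 1"
  from arg_cong[OF this, of total_degree] have "total_degree \<alpha> = 0 \<or> total_degree \<beta> = 0"
    by (simp del: total_degree_eq_0) linarith
  then show "\<alpha> = 0 \<and> \<beta> = axis i (1::nat) \<or> \<alpha> = axis i 1 \<and> \<beta> = 0"
    using * by auto
qed auto

lemma mps_nth_mult_axis:
  "mps_nth (f * g) (axis i 1) = mps_nth f 0 * mps_nth g (axis i 1) + mps_nth g 0 * mps_nth f (axis i 1)"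
proof -
  have "index_splits (axis i 1) = {(0, axis i 1), (axis i 1, 0)}"
    unfolding index_splits_def by (auto simp only: multiindex_add_eq_axis)
  then show ?thesis by (simp add: mps_nth_mult mult.commute)
qed

lemma deriv_along_mps_nth_axis:
  assumes "higher_derivation A \<theta>"
  shows "deriv_along (\<lambda>x. x) A (\<lambda>x. mps_nth (\<theta> x) (axis j 1))"
  using assms unfolding deriv_along_def higher_derivation_def is_ring_hom_def
  by (simp add: mps_nth_mult_axis del: One_nat_def)

text \<open>This is the rigidity behind both uniqueness and iterativity. \<open>A\<close> need not
  contain \<open>s\<close>, so a hypothetical nonzero derivation is first replaced by one on a ring
  that does.\<close>

lemma deriv_vanishes_jacobian:
  fixes s t :: "'a::field^'n::finite"
  assumes K: "is_subring K" and A: "is_subring A" "K \<subseteq> A" and t: "\<And>i. t $ i \<in> A"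
    and sep: "\<And>x. separable_algebraic (adjoin_field K s) x"
    and \<theta>: "higher_derivation UNIV \<theta>" "extends_hd_wrt K s \<theta>"
    and J: "det (jacobian_matrix \<theta> t) \<noteq> 0"
    and D: "deriv_along (\<lambda>x. x) A D" and D0: "\<And>x. x \<in> K \<union> range (($) t) \<Longrightarrow> D x = 0" and x: "x \<in> A"
  shows "D x = 0"
proof (rule ccontr)
  assume "D x \<noteq> 0"
  have "\<exists>A' D' x'. is_subring A' \<and> deriv_along (\<lambda>x. x) A' D' \<and> A \<subseteq> A' \<and> range (($) s) \<subseteq> A' \<and>
      (\<forall>x\<in>K \<union> range (($) t). D' x = 0) \<and> x' \<in> A' \<and> D' x' \<noteq> 0"
    by (rule nonzero_deriv_adjoin_finite[OF _ A(1) D _ D0 x]) (use A t \<open>D x \<noteq> 0\<close> in auto)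
  then obtain A' D' x' where A': "is_subring A'" "deriv_along (\<lambda>x. x) A' D'" "A \<subseteq> A'" "range (($) s) \<subseteq> A'"
    and D'0: "\<And>x. x \<in> K \<union> range (($) t) \<Longrightarrow> D' x = 0" and x': "x' \<in> A'" "D' x' \<noteq> 0"
    by blast
  define d where "d j x = mps_nth (\<theta> x) (axis j 1)" for j x
  \<comment> \<open>Subtracting the combination of partial derivatives with the same values on
    \<open>s\<close> leaves a derivation vanishing on \<open>K\<close> and \<open>s\<close>, hence
    on all of \<open>A'\<close> by separability.\<close>
  define E where "E x = D' x - (\<Sum>j\<in>UNIV. D' (s $ j) * d j x)" for x
  have d: "d j (x + y) = d j x + d j y" "d j (x * y) = x * d j y + y * d j x" for j x y
    using deriv_along_mps_nth_axis[OF \<theta>(1), of j] by (auto simp: deriv_along_def d_def)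
  have E: "deriv_along (\<lambda>x. x) A' E"
    unfolding deriv_along_def
  proof (intro ballI conjI)
    fix x y assume "x \<in> A'" "y \<in> A'"
    then show "E (x + y) = E x + E y" "E (x * y) = x * E y + y * E x"
      by (simp_all add: E_def d deriv_along_add[OF A'(2)] deriv_along_mult[OF A'(2)]
          sum.distrib sum_distrib_left algebra_simps)
  qed
  have EK: "E c = 0" if "c \<in> K" for c
    using D'0 that \<theta>(2) by (simp add: E_def d_def extends_hd_wrt_def mps_nth_const)
  have Es: "E (s $ i) = 0" for i
  proof -
    have "(\<Sum>j\<in>UNIV. D' (s $ j) * d j (s $ i)) = (\<Sum>j\<in>UNIV. if j = i then D' (s $ i) else 0)"
      using \<theta>(2) by (intro sum.cong)
        (auto simp: d_def extends_hd_wrt_def mps_nth_const mps_nth_var axis_eq_axis)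
    then show ?thesis by (simp add: E_def)
  qed
  have E0: "E x = 0" if "x \<in> A'" for x
    by (rule deriv_vanishes_separable[OF K _ A'(1) E _ Es EK that sep]) (use A' A in auto)
  \<comment> \<open>Both \<open>E\<close> and \<open>D'\<close> vanish on \<open>t\<close>, so the
    vector of values \<open>D' (s $ j)\<close> lies in the kernel of the Jacobian matrix.\<close>
  define v where "v = (\<chi> j. D' (s $ j))"
  have "jacobian_matrix \<theta> t *v v = 0"
  proof (rule vec_eq_iff[THEN iffD2], rule allI)
    fix i
    have "0 = E (t $ i)" using E0 t A'(3) by auto
    also have "\<dots> = - (\<Sum>j\<in>UNIV. d j (t $ i) * D' (s $ j))"
      using D'0 by (simp add: E_def mult.commute)
    finally show "(jacobian_matrix \<theta> t *v v) $ i = 0 $ i"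
      by (simp add: matrix_vector_mult_def jacobian_matrix_def v_def d_def)
  qed
  moreover have "jacobian_matrix \<theta> t *v 0 = 0" by (simp add: vec_eq_iff matrix_vector_mult_def)
  ultimately have "v = 0" by (simp only: cramer[OF J])
  then have "D' (s $ j) = 0" for j by (simp add: v_def vec_eq_iff)
  then have "D' x' = E x'" by (simp add: E_def)
  then show False using x' E0 by simp
qed


section \<open>Iterativity\<close>

lemma multi_binomial_self [simp]: "multi_binomial \<alpha> \<alpha> = 1"
  by (simp add: multi_binomial_def)

lemma multi_binomial_0 [simp]: "multi_binomial \<alpha> 0 = 1"
  by (simp add: multi_binomial_def)

lemma multi_binomial_eq_0: "\<not> (\<forall>i. \<beta> $ i \<le> \<alpha> $ i) \<Longrightarrow> multi_binomial \<alpha> \<beta> = 0"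
  by (auto simp: multi_binomial_def not_le)

text \<open>The one-variable identity is applied in each coordinate. When the product of sums is
  expanded, the choice functions are the multi-indices below \<alpha>, each paired with its
  complement.\<close>

lemma multi_binomial_vandermonde:
  "multi_binomial (\<gamma> + \<delta>) \<alpha> =
    (\<Sum>(\<beta>, \<epsilon>)\<in>index_splits \<alpha>. multi_binomial \<gamma> \<beta> * multi_binomial \<delta> \<epsilon>)"
  for \<alpha> \<gamma> \<delta> :: "nat^'n::finite"
proof -
  let ?b = "\<lambda>i k. (\<gamma> $ i choose k) * (\<delta> $ i choose (\<alpha> $ i - k))"
  have "multi_binomial (\<gamma> + \<delta>) \<alpha> = (\<Prod>i\<in>UNIV. \<Sum>k\<le>\<alpha> $ i. ?b i k)"
    by (simp add: multi_binomial_def vandermonde)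
  also have "\<dots> = (\<Sum>h\<in>(\<Pi>\<^sub>E i\<in>UNIV. {..\<alpha> $ i}). \<Prod>i\<in>UNIV. ?b i (h i))"
    by (rule prod_sum_PiE) auto
  also have "\<dots> = (\<Sum>(\<beta>, \<epsilon>)\<in>index_splits \<alpha>. multi_binomial \<gamma> \<beta> * multi_binomial \<delta> \<epsilon>)"
    by (rule sum.reindex_bij_witness[where i = "\<lambda>(\<beta>, \<epsilon>). ($) \<beta>" and j = "\<lambda>h. (\<chi> i. h i, \<chi> i. \<alpha> $ i - h i)"])
       (auto simp: vec_eq_iff multi_binomial_def prod.distrib PiE_iff intro!: prod.cong,
        (metis add_diff_cancel_left' le_add1)+)
  finally show ?thesis .
qed

text \<open>The substitution \<open>T \<mapsto> T + U\<close>, with the coefficients of the powers of \<open>U\<close> being series in \<open>T\<close>.\<close>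

definition mps_shift :: "('a::comm_ring_1, 'n::finite) mps \<Rightarrow> (('a, 'n) mps, 'n) mps" where
  "mps_shift f = Abs_mps (\<lambda>\<beta>. Abs_mps (\<lambda>\<alpha>. of_nat (multi_binomial (\<alpha> + \<beta>) \<alpha>) * mps_nth f (\<alpha> + \<beta>)))"

lemma mps_nth_shift:
  "mps_nth (mps_nth (mps_shift f) \<beta>) \<alpha> = of_nat (multi_binomial (\<alpha> + \<beta>) \<alpha>) * mps_nth f (\<alpha> + \<beta>)"
  by (simp add: mps_shift_def Abs_mps_inverse)

lemma mps_shift_add: "mps_shift (f + g) = mps_shift f + mps_shift g"
  by (intro mps_eqI) (simp add: mps_nth_shift distrib_left)

lemma mps_shift_1: "mps_shift 1 = 1"
  by (intro mps_eqI) (auto simp: mps_nth_shift mps_nth_1)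

text \<open>Both sides become sums over a split (\<gamma>, \<delta>) of \<alpha> + \<beta> and a
  split (\<mu>, \<nu>) of \<alpha>; the Vandermonde identity distributes the binomial coefficient
  over the latter.\<close>

lemma mps_shift_mult: "mps_shift (f * g) = mps_shift f * mps_shift g"
  for f g :: "('a::comm_ring_1, 'n::finite) mps"
proof (intro mps_eqI)
  fix \<alpha> \<beta> :: "nat^'n"
  define t where "t = (\<lambda>((\<gamma>, \<delta>), (\<mu>, \<nu>)). of_nat (multi_binomial \<gamma> \<mu> * multi_binomial \<delta> \<nu>) *
    (mps_nth f \<gamma> * mps_nth g \<delta>))"
  \<comment> \<open>Outside \<open>S\<close> a binomial coefficient is zero. On \<open>S\<close> the
    differences \<gamma> - \<mu> and \<delta> - \<nu> are not truncated, so they can be used to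
    reindex by splits of \<beta>.\<close>
  define S where "S = {((\<gamma>, \<delta>), (\<mu>, \<nu>)). \<gamma> + \<delta> = \<alpha> + \<beta> \<and> \<mu> + \<nu> = \<alpha> \<and>
    (\<forall>i. \<mu> $ i \<le> \<gamma> $ i) \<and> (\<forall>i. \<nu> $ i \<le> \<delta> $ i)}"
  have "mps_nth (mps_nth (mps_shift (f * g)) \<beta>) \<alpha> =
      (\<Sum>(\<gamma>, \<delta>)\<in>index_splits (\<alpha> + \<beta>). of_nat (multi_binomial (\<alpha> + \<beta>) \<alpha>) * (mps_nth f \<gamma> * mps_nth g \<delta>))"
    by (simp add: mps_nth_shift mps_nth_mult sum_distrib_left case_prod_unfold)
  also have "\<dots> = (\<Sum>p\<in>index_splits (\<alpha> + \<beta>). \<Sum>q\<in>index_splits \<alpha>. t (p, q))"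
  proof (intro sum.cong refl, clarify)
    fix \<gamma> \<delta> :: "nat^'n" assume "(\<gamma>, \<delta>) \<in> index_splits (\<alpha> + \<beta>)"
    then have "\<alpha> + \<beta> = \<gamma> + \<delta>" by simp
    then have "multi_binomial (\<alpha> + \<beta>) \<alpha> =
        (\<Sum>(\<mu>, \<nu>)\<in>index_splits \<alpha>. multi_binomial \<gamma> \<mu> * multi_binomial \<delta> \<nu>)"
      by (simp only: multi_binomial_vandermonde)
    then show "of_nat (multi_binomial (\<alpha> + \<beta>) \<alpha>) * (mps_nth f \<gamma> * mps_nth g \<delta>) =
        (\<Sum>q\<in>index_splits \<alpha>. t ((\<gamma>, \<delta>), q))"
      by (simp add: t_def case_prod_unfold sum_distrib_right)
  qed
  also have "\<dots> = (\<Sum>p\<in>index_splits (\<alpha> + \<beta>) \<times> index_splits \<alpha>. t p)"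
    by (simp add: sum.cartesian_product)
  also have "\<dots> = (\<Sum>p\<in>S. t p)"
  proof (rule sum.mono_neutral_right)
    show "\<forall>p\<in>index_splits (\<alpha> + \<beta>) \<times> index_splits \<alpha> - S. t p = 0"
    proof clarify
      fix \<gamma> \<delta> \<mu> \<nu> :: "nat^'n"
      assume "((\<gamma>, \<delta>), (\<mu>, \<nu>)) \<notin> S" "(\<gamma>, \<delta>) \<in> index_splits (\<alpha> + \<beta>)" "(\<mu>, \<nu>) \<in> index_splits \<alpha>"
      then have "\<not> (\<forall>i. \<mu> $ i \<le> \<gamma> $ i) \<or> \<not> (\<forall>i. \<nu> $ i \<le> \<delta> $ i)"
        by (auto simp: S_def)
      then have "multi_binomial \<gamma> \<mu> = 0 \<or> multi_binomial \<delta> \<nu> = 0"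
        by (elim disjE) (simp_all only: multi_binomial_eq_0 simp_thms)
      then show "t ((\<gamma>, \<delta>), (\<mu>, \<nu>)) = 0" by (auto simp: t_def)
    qed
  qed (auto simp: S_def)
  also have "\<dots> = (\<Sum>(p, q)\<in>index_splits \<beta> \<times> index_splits \<alpha>. t ((fst q + fst p, snd q + snd p), q))"
  proof (rule sum.reindex_bij_witness
      [where i = "\<lambda>(p, q). ((fst q + fst p, snd q + snd p), q)"
         and j = "\<lambda>(p, q). ((fst p - fst q, snd p - snd q), q)"])
    fix p assume "p \<in> S"
    then obtain \<gamma> \<delta> \<mu> \<nu> where p: "p = ((\<gamma>, \<delta>), (\<mu>, \<nu>))" "\<gamma> + \<delta> = \<alpha> + \<beta>" "\<mu> + \<nu> = \<alpha>"
      "\<And>i. \<mu> $ i \<le> \<gamma> $ i" "\<And>i. \<nu> $ i \<le> \<delta> $ i" by (auto simp: S_def)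
    have "(\<gamma> - \<mu> + (\<delta> - \<nu>)) $ i = \<beta> $ i" for i
      using p(4,5)[of i] arg_cong[OF p(2), of "\<lambda>v. v $ i"] arg_cong[OF p(3), of "\<lambda>v. v $ i"]
      by simp
    then show "(case p of (p, q) \<Rightarrow> ((fst p - fst q, snd p - snd q), q)) \<in> index_splits \<beta> \<times> index_splits \<alpha>"
      using p by (simp add: vec_eq_iff)
    show "(case case p of (p, q) \<Rightarrow> ((fst p - fst q, snd p - snd q), q) of
        (p, q) \<Rightarrow> ((fst q + fst p, snd q + snd p), q)) = p"
      using p by (simp add: vec_eq_iff)
    then show "(case case p of (p, q) \<Rightarrow> ((fst p - fst q, snd p - snd q), q) of
        (p, q) \<Rightarrow> t ((fst q + fst p, snd q + snd p), q)) = t p"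
      by (simp add: case_prod_unfold)
  qed (auto simp: S_def vec_eq_iff algebra_simps)
  also have "\<dots> = (\<Sum>p\<in>index_splits \<beta>. \<Sum>q\<in>index_splits \<alpha>. t ((fst q + fst p, snd q + snd p), q))"
    by (rule sum.cartesian_product[symmetric])
  also have "\<dots> = (\<Sum>(\<gamma>, \<delta>)\<in>index_splits \<beta>. \<Sum>(\<mu>, \<nu>)\<in>index_splits \<alpha>.
      (of_nat (multi_binomial (\<mu> + \<gamma>) \<mu>) * mps_nth f (\<mu> + \<gamma>)) *
      (of_nat (multi_binomial (\<nu> + \<delta>) \<nu>) * mps_nth g (\<nu> + \<delta>)))"
    by (simp add: t_def case_prod_unfold mult_ac)
  also have "\<dots> = mps_nth (mps_nth (mps_shift f * mps_shift g) \<beta>) \<alpha>"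
    by (simp add: mps_nth_mult[of "mps_shift f"] mps_nth_sum mps_nth_mult[of "mps_nth _ _"] mps_nth_shift
        case_prod_unfold)
  finally show "mps_nth (mps_nth (mps_shift (f * g)) \<beta>) \<alpha> =
      mps_nth (mps_nth (mps_shift f * mps_shift g) \<beta>) \<alpha>" .
qed

text \<open>
  Iterativity says that the two homomorphisms \<open>A \<rightarrow> A[[T]][[U]]\<close> obtained from \<open>\<theta>\<close> by applying it
  twice and by substituting \<open>T + U\<close> coincide; rigidity reduces this to the generators.
\<close>

lemma iterative_of_rigid:
  fixes t :: "'a::comm_ring_1^'n::finite"
  assumes A: "is_subring A" and \<theta>: "higher_derivation A \<theta>"
    and K: "K \<subseteq> A" "\<And>c. c \<in> K \<Longrightarrow> \<theta> c = mps_const c"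
    and t: "\<And>i. t $ i \<in> A" "\<And>i. \<theta> (t $ i) = mps_const (t $ i) + mps_var i"
    and rigid: "\<And>D x. deriv_along (\<lambda>x. x) A D \<Longrightarrow> (\<And>x. x \<in> K \<union> range (($) t) \<Longrightarrow> D x = 0) \<Longrightarrow>
      x \<in> A \<Longrightarrow> D x = (0::'a)"
  shows "iterative_higher_derivation A \<theta>"
proof -
  have hom: "is_ring_hom A (mps_over A) \<theta>" and \<theta>0: "\<And>x. x \<in> A \<Longrightarrow> mps_nth (\<theta> x) 0 = x"
    using \<theta> by (auto simp: higher_derivation_def)
  have coeff: "mps_nth (\<theta> x) \<alpha> \<in> A" if "x \<in> A" for x \<alpha>
    using hom that by (auto simp: is_ring_hom_def mps_over_def)
  have \<theta>_zero: "\<theta> 0 = 0" using is_ring_hom_0[OF hom A] .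
  have \<theta>_one: "\<theta> 1 = 1" using hom by (simp add: is_ring_hom_def)
  \<comment> \<open>The outer index \<beta> comes from the first application of \<theta>, the inner
    one from the second.\<close>
  define \<Phi> where "\<Phi> x = Abs_mps (\<lambda>\<beta>. \<theta> (mps_nth (\<theta> x) \<beta>))" for x
  have \<Phi>: "mps_nth (\<Phi> x) \<beta> = \<theta> (mps_nth (\<theta> x) \<beta>)" for x \<beta>
    by (simp add: \<Phi>_def Abs_mps_inverse)
  have hom\<Phi>: "is_ring_hom A UNIV \<Phi>"
    unfolding is_ring_hom_def
  proof (intro conjI ballI)
    show "\<Phi> 1 = 1"
      by (intro mps_eqI[of "\<Phi> 1"]) (simp add: \<Phi> \<theta>_one mps_nth_1 \<theta>_zero)
    fix x y assume xy: "x \<in> A" "y \<in> A"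
    show "\<Phi> (x + y) = \<Phi> x + \<Phi> y"
      using hom xy by (intro mps_eqI[of "\<Phi> _"]) (simp add: \<Phi> is_ring_hom_def coeff)
    show "\<Phi> (x * y) = \<Phi> x * \<Phi> y"
    proof (rule mps_eqI)
      fix \<beta>
      have "mps_nth (\<Phi> (x * y)) \<beta> =
          \<theta> (\<Sum>p\<in>index_splits \<beta>. mps_nth (\<theta> x) (fst p) * mps_nth (\<theta> y) (snd p))"
        using hom xy by (simp add: \<Phi> is_ring_hom_def mps_nth_mult case_prod_unfold)
      also have "\<dots> = (\<Sum>p\<in>index_splits \<beta>. \<theta> (mps_nth (\<theta> x) (fst p) * mps_nth (\<theta> y) (snd p)))"
        using xy coeff by (intro is_ring_hom_sum[OF hom A] is_subring_mult[OF A])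
      also have "\<dots> = mps_nth (\<Phi> x * \<Phi> y) \<beta>"
        using hom xy coeff by (simp add: mps_nth_mult \<Phi> is_ring_hom_def case_prod_unfold)
      finally show "mps_nth (\<Phi> (x * y)) \<beta> = mps_nth (\<Phi> x * \<Phi> y) \<beta>" .
    qed
  qed simp
  have hom_shift: "is_ring_hom A UNIV (\<lambda>x. mps_shift (\<theta> x))"
    using hom by (simp add: is_ring_hom_def mps_shift_add mps_shift_mult mps_shift_1)
  have shift0: "mps_nth (mps_shift f) 0 = f" for f :: "('a, 'n) mps"
    by (rule mps_eqI) (simp add: mps_nth_shift)
  have agree: "\<Phi> x = mps_shift (\<theta> x)" if x: "x \<in> K \<union> range (($) t)" for x
  proof (intro mps_eqI)
    fix \<beta> \<alpha>
    consider "x \<in> K" | i where "x = t $ i" using x by auto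
    then show "mps_nth (mps_nth (\<Phi> x) \<beta>) \<alpha> = mps_nth (mps_nth (mps_shift (\<theta> x)) \<beta>) \<alpha>"
    proof cases
      case 1
      then show ?thesis by (simp add: \<Phi> K mps_nth_const mps_nth_shift \<theta>_zero)
    next
      case (2 i)
      show ?thesis
      proof (cases "\<beta> = 0")
        case True
        then show ?thesis using 2 \<theta>0[OF t(1)] by (simp add: \<Phi> shift0)
      next
        case False
        then show ?thesis
          using 2 by (auto simp: \<Phi> t(2) mps_nth_const mps_nth_var mps_nth_shift \<theta>_zero \<theta>_one
            multiindex_add_eq_axis mps_nth_1 simp del: One_nat_def)
      qed
    qed
  qed
  \<comment> \<open>In the outer variables both homomorphisms have constant term
    \<open>\<theta> x\<close>, so rigidity is needed for derivations along \<theta>.\<close>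
  have "\<Phi> x = mps_shift (\<theta> x)" if "x \<in> A" for x
  proof (rule ring_hom_mps_eqI[OF hom\<Phi> hom_shift _ _ agree _ that, where \<phi> = \<theta>])
    show "mps_nth (\<Phi> x) 0 = \<theta> x" if "x \<in> A" for x using \<theta>0[OF that] by (simp add: \<Phi>)
    show "mps_nth (mps_shift (\<theta> x)) 0 = \<theta> x" for x by (rule shift0)
    show "D x = 0" if "deriv_along \<theta> A D" "\<And>x. x \<in> K \<union> range (($) t) \<Longrightarrow> D x = 0" "x \<in> A"
      for D :: "'a \<Rightarrow> ('a, 'n) mps" and x
    proof (rule rigid_along_mps[where A = A and \<phi> = \<theta> and C = "K \<union> range (($) t)"])
      show "D x = 0" if "deriv_along (\<lambda>x. x) A D" "\<And>x. x \<in> K \<union> range (($) t) \<Longrightarrow> D x = 0" "x \<in> A"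
        for D :: "'a \<Rightarrow> 'a" and x
        using that by (rule rigid)
    qed (use \<theta>0 that in auto)
  qed
  then have "mps_nth (\<theta> (mps_nth (\<theta> x) \<beta>)) \<alpha> = mps_nth (mps_nth (mps_shift (\<theta> x)) \<beta>) \<alpha>"
    if "x \<in> A" for x \<alpha> \<beta>
    using that by (metis \<Phi>)
  then show ?thesis using \<theta> by (simp add: iterative_higher_derivation_def mps_nth_shift)
qed

section \<open>Higher derivations with respect to a system of elements\<close>

lemma mps_hom_monomial_eval:
  assumes "is_ring_hom A B \<theta>" "is_subring A" "\<And>i. t $ i \<in> A"
  shows "\<theta> (monomial_eval t \<alpha>) = mps_monomial (\<lambda>i. \<theta> (t $ i)) \<alpha>"
  using assms
  by (simp add: monomial_eval_def mps_monomial_def is_ring_hom_prod is_ring_hom_power is_subring_power)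

text \<open>The coefficients of \<open>p\<close> in top degree are coefficients of \<open>\<theta>(p(t)) = p(t + T)\<close>.\<close>

lemma alg_independent_of_hom:
  fixes t :: "'a::comm_ring_1^'n::finite" and \<theta> :: "'a \<Rightarrow> ('a, 'n) mps"
  assumes A: "is_subring A" and hom: "is_ring_hom A B \<theta>"
    and K: "K \<subseteq> A" "\<And>c. c \<in> K \<Longrightarrow> \<theta> c = mps_const c"
    and t: "\<And>i. t $ i \<in> A" "\<And>i. \<theta> (t $ i) = mps_const (t $ i) + mps_var i"
  shows "alg_independent K t"
  unfolding alg_independent_def
proof (intro ballI impI, rule ccontr)
  fix p :: "(nat^'n) \<Rightarrow>\<^sub>0 'a" assume p: "p \<in> polys_over K" "poly_eval t p = 0" "p \<noteq> 0"
  let ?S = "Poly_Mapping.keys p" and ?p = "Poly_Mapping.lookup p"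
  let ?N = "Max (total_degree ` ?S)"
  have "?N \<in> total_degree ` ?S" using p by (intro Max_in) auto
  then obtain \<beta> where \<beta>: "\<beta> \<in> ?S" "total_degree \<beta> = ?N" by auto
  have le: "total_degree \<alpha> \<le> total_degree \<beta>" if "\<alpha> \<in> ?S" for \<alpha>
    using that by (simp add: \<beta>)
  define m where "m \<alpha> = mps_monomial (\<lambda>i. mps_const (t $ i) + mps_var i) \<alpha>" for \<alpha>
  \<comment> \<open>In \<open>t $ i\<close> plus the variable, the variable is the only term of
    degree at least 1; this is the case \<sigma> = -1.\<close>
  have m: "dominant_monomial (-1) \<alpha> (m \<alpha>)" for \<alpha>
    unfolding m_def
    by (rule dominant_monomial_monomial) (auto simp: dominant_monomial_def mps_nth_const mps_nth_var)
  have pK: "?p \<alpha> \<in> K" for \<alpha> using p by (simp add: polys_over_def)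
  have mA: "monomial_eval t \<alpha> \<in> A" for \<alpha>
    unfolding monomial_eval_def using t by (intro is_subring_prod is_subring_power A) auto
  have \<theta>m: "\<theta> (?p \<alpha> * monomial_eval t \<alpha>) = mps_const (?p \<alpha>) * m \<alpha>" for \<alpha>
  proof -
    have "\<theta> (?p \<alpha> * monomial_eval t \<alpha>) = \<theta> (?p \<alpha>) * \<theta> (monomial_eval t \<alpha>)"
      using hom pK[of \<alpha>] mA[of \<alpha>] K(1) unfolding is_ring_hom_def by blast
    then show ?thesis using K(2)[OF pK] mps_hom_monomial_eval[OF hom A t(1)] t(2) by (simp add: m_def)
  qed
  have "0 = \<theta> (poly_eval t p)" using p is_ring_hom_0[OF hom A] by simp
  also have "\<dots> = (\<Sum>\<alpha>\<in>?S. \<theta> (?p \<alpha> * monomial_eval t \<alpha>))"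
    using pK mA K(1)
    by (auto simp: poly_eval_eq_sum[OF finite_keys subset_refl]
        intro!: is_ring_hom_sum[OF hom A] is_subring_mult[OF A])
  also have "\<dots> = (\<Sum>\<alpha>\<in>?S. mps_const (?p \<alpha>) * m \<alpha>)"
    by (simp add: \<theta>m)
  finally have "0 = (\<Sum>\<alpha>\<in>?S. ?p \<alpha> * mps_nth (m \<alpha>) \<beta>)"
    using mps_nth_sum[of "\<lambda>\<alpha>. mps_const (?p \<alpha>) * m \<alpha>" ?S \<beta>] by simp
  \<comment> \<open>As \<beta> has maximal degree, every monomial other than that of index \<beta>
    has coefficient 0 at \<beta>.\<close>
  also have "\<dots> = (\<Sum>\<alpha>\<in>?S. if \<alpha> = \<beta> then ?p \<beta> else 0)"
    using m le by (intro sum.cong) (auto simp: dominant_monomial_def)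
  also have "\<dots> = ?p \<beta>" using \<beta> by simp
  finally show False using \<beta> by (simp add: in_keys_iff)
qed

text \<open>The point is that \<theta> maps \<open>K[t]\<close> into \<open>K[t][[T]]\<close>: the
  elements of \<open>A\<close> whose image has coefficients in \<open>K[t]\<close> form a subring
  containing \<open>K\<close> and all \<open>t $ i\<close>.\<close>

lemma extends_hd_wrtI:
  fixes t :: "'a::comm_ring_1^'n::finite"
  assumes A: "is_subring A" and hom: "is_ring_hom A B \<theta>"
    and K: "is_subring K" "K \<subseteq> A" "\<And>c. c \<in> K \<Longrightarrow> \<theta> c = mps_const c"
    and t: "\<And>i. t $ i \<in> A" "\<And>i. \<theta> (t $ i) = mps_const (t $ i) + mps_var i"
  shows "extends_hd_wrt K t \<theta>"
proof -
  let ?S = "adjoin_ring K t"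
  have S: "is_subring ?S" by (rule is_subring_adjoin_ring[OF K(1)])
  have over: "is_subring (mps_over ?S :: ('a, 'n) mps set)" by (rule is_subring_mps_over[OF S])
  have "is_subring {x \<in> A. \<theta> x \<in> mps_over ?S}"
    unfolding is_subring_def
  proof (intro conjI ballI)
    show "1 \<in> {x \<in> A. \<theta> x \<in> mps_over ?S}"
      using hom is_subring_1[OF A] is_subring_1[OF over] by (simp add: is_ring_hom_def)
    fix x y assume *: "x \<in> {x \<in> A. \<theta> x \<in> mps_over ?S}" "y \<in> {x \<in> A. \<theta> x \<in> mps_over ?S}"
    then show "x - y \<in> {x \<in> A. \<theta> x \<in> mps_over ?S}"
      using is_ring_hom_diff[OF hom A, of x y] by (simp add: is_subring_diff[OF over] is_subring_diff[OF A])
    show "x * y \<in> {x \<in> A. \<theta> x \<in> mps_over ?S}"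
      using * hom by (simp add: is_ring_hom_def is_subring_mult[OF over] is_subring_mult[OF A])
  qed
  then have "?S \<subseteq> {x \<in> A. \<theta> x \<in> mps_over ?S}"
    using K t adjoin_ring_base[OF K(1), of t] adjoin_ring_var[OF K(1), of t]
    by (intro adjoin_ring_subset)
      (auto intro!: mps_over_const[OF S] mps_over_var[OF S] is_subring_add[OF over])
  then show ?thesis
    using hom K(3) t(2) by (auto simp: extends_hd_wrt_def is_ring_hom_def subset_iff)
qed

text \<open>By Cramer's rule the columns of \<open>M\<close> solve the systems with the unit vectors
  as right-hand sides. The only denominator is \<open>det J\<close>, whose inverse lies in
  \<open>A\<close>.\<close>

lemma matrix_inverse_in_subring:
  fixes J :: "'a::field^'n::finite^'n"
  assumes A: "is_subring A" and J: "\<And>i j. J $ i $ j \<in> A" and inv: "invertible_in A (det J)"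
  obtains M :: "'a^'n^'n" where "\<And>i j. M $ i $ j \<in> A"
    "\<And>i k. (\<Sum>j\<in>UNIV. J $ i $ j * M $ j $ k) = (if i = k then 1 else 0)"
proof
  obtain y where y: "y \<in> A" "det J * y = 1" using inv by (auto simp: invertible_in_def)
  then have nz: "det J \<noteq> 0" by auto
  have yinv: "inverse (det J) = y" using y by (simp add: inverse_unique)
  define C where "C j k = (\<chi> i l. if l = j then axis k 1 $ i else J $ i $ l)" for j k
  define M where "M = (\<chi> j k. det (C j k) / det J)"
  show "M $ j $ k \<in> A" for j k
  proof -
    have "det (C j k) \<in> A"
      by (rule is_subring_det[OF A])
        (simp add: C_def axis_def J is_subring_0[OF A] is_subring_1[OF A])
    then show ?thesis using y yinv by (simp add: M_def divide_inverse is_subring_mult[OF A])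
  qed
  fix i k
  have "J *v (\<chi> j. M $ j $ k) = axis k 1"
    unfolding cramer[OF nz] by (simp add: M_def C_def)
  then have "(J *v (\<chi> j. M $ j $ k)) $ i = axis k 1 $ i" by simp
  then show "(\<Sum>j\<in>UNIV. J $ i $ j * M $ j $ k) = (if i = k then 1 else 0)"
    by (simp add: matrix_vector_mult_def axis_def)
qed

text \<open>
  A linear change of the variables \<open>T\<close> turns the Jacobian of \<open>\<theta>\<close> into the identity matrix; then the
  substitution \<open>T\<^sub>i \<mapsto> \<theta>(t\<^sub>i) - t\<^sub>i\<close> is inverted.
\<close>

lemma higher_derivation_wrt_exists:
  fixes t :: "'a::field^'n::finite"
  assumes A: "is_subring A" and \<theta>: "higher_derivation A \<theta>" and t: "\<And>i. t $ i \<in> A"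
    and inv: "invertible_in A (det (jacobian_matrix \<theta> t))"
  obtains \<theta>' where "higher_derivation A \<theta>'" "\<And>i. \<theta>' (t $ i) = mps_const (t $ i) + mps_var i"
    "\<And>c. \<theta> c = mps_const c \<Longrightarrow> \<theta>' c = mps_const c"
proof -
  have hom: "is_ring_hom A (mps_over A) \<theta>" and \<theta>0: "\<And>x. x \<in> A \<Longrightarrow> mps_nth (\<theta> x) 0 = x"
    using \<theta> by (auto simp: higher_derivation_def)
  have over: "\<theta> x \<in> mps_over A" if "x \<in> A" for x
    using hom that by (auto simp: is_ring_hom_def)
  note overA = is_subring_mps_over[OF A]
  have J: "jacobian_matrix \<theta> t $ i $ j \<in> A" for i j
    using over t by (simp add: jacobian_matrix_def mps_over_def)
  obtain M :: "'a^'n^'n" where M: "\<And>i j. M $ i $ j \<in> A"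
    and JM: "\<And>i k. (\<Sum>j\<in>UNIV. jacobian_matrix \<theta> t $ i $ j * M $ j $ k) = (if i = k then 1 else 0)"
    by (rule matrix_inverse_in_subring[OF A J inv]) blast
  \<comment> \<open>Substituting the linear forms with coefficient matrix \<open>M\<close>
    multiplies the Jacobian on the right by its inverse.\<close>
  define l where "l j = (\<Sum>k\<in>UNIV. mps_const (M $ j $ k) * mps_var k)" for j
  have l0: "mps_nth (l j) 0 = 0" for j
    by (simp add: l_def mps_nth_sum mps_nth_var)
  have l1: "mps_nth (l j) (axis k 1) = M $ j $ k" for j k
    by (simp add: l_def mps_nth_sum mps_nth_var axis_eq_axis if_distrib[of "(*) _"] cong: if_cong)
  have l_over: "l j \<in> mps_over A" for j
    unfolding l_def
    by (intro is_subring_sum[OF overA] is_subring_mult[OF overA] mps_over_const mps_over_var A M)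
  define \<Lambda> where "\<Lambda> x = mps_subst l (\<theta> x)" for x
  have \<Lambda>_over: "\<Lambda> x \<in> mps_over A" if "x \<in> A" for x
    unfolding \<Lambda>_def by (rule mps_subst_over[OF l0 A l_over over[OF that]])
  have \<Lambda>0: "mps_nth (\<Lambda> x) 0 = x" if "x \<in> A" for x
    unfolding \<Lambda>_def mps_nth_subst_0[OF l0] by (rule \<theta>0[OF that])
  have \<Lambda>1: "mps_nth (\<Lambda> (t $ i)) (axis k 1) = (if i = k then 1 else 0)" for i k
    unfolding \<Lambda>_def mps_nth_subst_axis[OF l0] l1 using JM[of i k] by (simp add: jacobian_matrix_def)
  define g where "g i = \<Lambda> (t $ i) - mps_const (t $ i)" for i
  have g: "dominant_monomial 1 (axis i 1) (g i)" for i
    unfolding dominant_monomial_def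
  proof (intro allI impI)
    fix \<gamma> :: "nat^'n" assume "1 * int (total_degree \<gamma>) \<le> 1 * int (total_degree (axis i 1 :: nat^'n))"
    then have "\<gamma> \<in> {\<gamma>. total_degree \<gamma> \<le> 1}" by simp
    then consider "\<gamma> = 0" | k where "\<gamma> = axis k 1" unfolding total_degree_le_1 by auto
    then show "mps_nth (g i) \<gamma> = (if \<gamma> = axis i 1 then 1 else 0)"
    proof cases
      case 1
      then show ?thesis using \<Lambda>0 t by (auto simp: g_def mps_nth_const axis_eq_0_iff)
    next
      case 2
      then show ?thesis using \<Lambda>1 by (auto simp: g_def mps_nth_const axis_eq_axis simp del: One_nat_def)
    qed
  qed
  have g0: "mps_nth (g i) 0 = 0" for i
    using \<Lambda>0 t by (simp add: g_def mps_nth_const)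
  have g_over: "g i \<in> mps_over A" for i
    unfolding g_def using t by (intro is_subring_diff[OF overA] \<Lambda>_over mps_over_const A)
  \<comment> \<open>\<open>\<theta>' x\<close> is the unique series with
    \<open>mps_subst g (\<theta>' x) = \<Lambda> x\<close>, so identities for
    \<open>\<theta>'\<close> are checked after substitution. The variable of index \<open>i\<close>
    becomes \<open>g i = \<Lambda> (t $ i) - mps_const (t $ i)\<close>, which gives the value at
    \<open>t $ i\<close>.\<close>
  define \<theta>' where "\<theta>' x = Abs_mps (subst_preimage g (\<Lambda> x))" for x
  have sub: "mps_subst g (\<theta>' x) = \<Lambda> x" for x
    unfolding \<theta>'_def by (rule mps_subst_preimage[OF g])
  have eqI: "\<theta>' x = f" if "mps_subst g f = \<Lambda> x" for x f
    using mps_subst_eqD[OF g, of "\<theta>' x" f] sub that by simp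
  note subst_arith = mps_subst_add[OF g0] mps_subst_mult[OF g0] mps_subst_const[OF g0] mps_subst_var[OF g0]
  have \<theta>'_const: "\<theta>' c = mps_const c" if "\<theta> c = mps_const c" for c
    using that by (intro eqI) (simp add: subst_arith \<Lambda>_def mps_subst_const[OF l0])
  have "is_ring_hom A (mps_over A) \<theta>'"
    unfolding is_ring_hom_def
  proof (intro conjI ballI)
    show "\<theta>' ` A \<subseteq> mps_over A"
      unfolding \<theta>'_def using subst_preimage_over[OF g A g_over] \<Lambda>_over by auto
    show "\<theta>' 1 = 1"
      using \<theta>'_const[of 1] hom by (simp add: is_ring_hom_def)
    fix x y assume "x \<in> A" "y \<in> A"
    then show "\<theta>' (x + y) = \<theta>' x + \<theta>' y" "\<theta>' (x * y) = \<theta>' x * \<theta>' y"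
      using hom
      by (auto intro!: eqI simp: subst_arith sub \<Lambda>_def is_ring_hom_def mps_subst_add[OF l0] mps_subst_mult[OF l0])
  qed
  moreover have "mps_nth (\<theta>' x) 0 = x" if "x \<in> A" for x
    using mps_nth_subst_0[of g "\<theta>' x", OF g0] sub \<Lambda>0[OF that] by simp
  ultimately have "higher_derivation A \<theta>'" by (simp add: higher_derivation_def)
  moreover have "\<theta>' (t $ i) = mps_const (t $ i) + mps_var i" for i
    by (rule eqI, simp add: subst_arith, simp add: g_def)
  ultimately show ?thesis using that \<theta>'_const by blast
qed

section \<open>Independence, existence and uniqueness on \<open>R\<close>\<close>

theorem theorem4p5:
  fixes K R :: "'a::field set"
    and s t :: "'a^'n::finite"
    and \<theta>s :: "'a \<Rightarrow> ('a, 'n) mps"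
  assumes "is_subfield K"
    and "alg_independent K s"
    and "\<forall>x. separable_algebraic (adjoin_field K s) x"
    and "higher_derivation UNIV \<theta>s"
    and "extends_hd_wrt K s \<theta>s"
    and "is_subalgebra K R"
    and "\<theta>s ` R \<subseteq> mps_over R"
    and "\<forall>i. t $ i \<in> R"
    and "invertible_in R (det (jacobian_matrix \<theta>s t))"
  shows "alg_independent K t \<and>
    (\<exists>!\<theta>. \<theta> \<in> extensional R \<and> iterative_higher_derivation R \<theta> \<and> extends_hd_wrt K t \<theta>)"
proof -
  have K: "is_subring K" using assms(1) by (simp add: is_subfield_def)
  have R: "is_subring R" "K \<subseteq> R" using assms(6) by (auto simp: is_subalgebra_def)
  have t: "t $ i \<in> R" for i using assms(8) by blast
  have hdR: "higher_derivation R \<theta>s"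
    using assms(4,7) by (simp add: higher_derivation_def is_ring_hom_def)
  have constK: "\<theta>s c = mps_const c" if "c \<in> K" for c
    using assms(5) that by (simp add: extends_hd_wrt_def)
  have rigid: "D x = 0"
    if "deriv_along (\<lambda>x. x) R D" "\<And>x. x \<in> K \<union> range (($) t) \<Longrightarrow> D x = 0" "x \<in> R" for D x
    by (rule deriv_vanishes_jacobian[OF K R t _ assms(4,5) _ that])
       (use assms(3,9) in \<open>auto simp: invertible_in_def\<close>)
  obtain \<theta>' where \<theta>': "higher_derivation R \<theta>'" "\<And>i. \<theta>' (t $ i) = mps_const (t $ i) + mps_var i"
      "\<And>c. \<theta>s c = mps_const c \<Longrightarrow> \<theta>' c = mps_const c"
    by (rule higher_derivation_wrt_exists[OF R(1) hdR t assms(9)]) blast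
  \<comment> \<open>Uniqueness is among functions with the default value \<open>undefined\<close>
    outside \<open>R\<close>, hence the restriction.\<close>
  define \<theta> where "\<theta> = restrict \<theta>' R"
  have \<theta>R: "\<theta> x = \<theta>' x" if "x \<in> R" for x using that by (simp add: \<theta>_def)
  have hd: "higher_derivation R \<theta>"
    using \<theta>'(1) by (simp add: higher_derivation_def is_ring_hom_def \<theta>R is_subring_closed[OF R(1)] image_subset_iff)
  then have hom: "is_ring_hom R (mps_over R) \<theta>" by (simp add: higher_derivation_def)
  have \<theta>t: "\<theta> (t $ i) = mps_const (t $ i) + mps_var i" for i
    using t \<theta>'(2) by (simp add: \<theta>R)
  have \<theta>K: "\<theta> c = mps_const c" if "c \<in> K" for c
    using that R(2) \<theta>'(3) constK by (auto simp: \<theta>R)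
  have "alg_independent K t"
    by (rule alg_independent_of_hom[OF R(1) hom R(2) \<theta>K t \<theta>t])
  moreover have "\<exists>!\<theta>. \<theta> \<in> extensional R \<and> iterative_higher_derivation R \<theta> \<and> extends_hd_wrt K t \<theta>"
  proof (rule ex1I[of _ \<theta>], intro conjI)
    show "\<theta> \<in> extensional R" by (simp add: \<theta>_def)
    show "iterative_higher_derivation R \<theta>"
    proof (rule iterative_of_rigid[OF R(1) hd R(2) _ t \<theta>t])
      show "D x = 0" if "deriv_along (\<lambda>x. x) R D" "\<And>x. x \<in> K \<union> range (($) t) \<Longrightarrow> D x = 0" "x \<in> R" for D x
        using that by (rule rigid)
    qed (rule \<theta>K)
    show "extends_hd_wrt K t \<theta>"
      by (rule extends_hd_wrtI[OF R(1) hom K R(2) \<theta>K t \<theta>t])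
    fix \<eta> assume "\<eta> \<in> extensional R \<and> iterative_higher_derivation R \<eta> \<and> extends_hd_wrt K t \<eta>"
    then have \<eta>: "\<eta> \<in> extensional R" "higher_derivation R \<eta>" "extends_hd_wrt K t \<eta>"
      by (auto simp: iterative_higher_derivation_def)
    \<comment> \<open>Both maps have constant term \<open>x\<close> and agree on \<open>K\<close>
      and \<open>t\<close>, so rigidity identifies them.\<close>
    have "\<eta> x = \<theta> x" if "x \<in> R" for x
    proof (rule ring_hom_mps_eqI[where \<phi> = "\<lambda>x. x" and C = "K \<union> range (($) t)", OF _ _ _ _ _ _ that])
      show "D x = 0" if "deriv_along (\<lambda>x. x) R D" "\<And>x. x \<in> K \<union> range (($) t) \<Longrightarrow> D x = 0" "x \<in> R" for D x
        using that by (rule rigid)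
      show "is_ring_hom R UNIV \<eta>" "is_ring_hom R UNIV \<theta>"
        using \<eta>(2) hd by (auto simp: higher_derivation_def intro: is_ring_hom_mono)
      show "mps_nth (\<eta> x) 0 = x" "mps_nth (\<theta> x) 0 = x" if "x \<in> R" for x
        using \<eta>(2) hd that by (auto simp: higher_derivation_def)
      show "\<eta> x = \<theta> x" if "x \<in> K \<union> range (($) t)" for x
        using that \<eta>(3) \<theta>K \<theta>t by (auto simp: extends_hd_wrt_def)
    qed
    then show "\<eta> = \<theta>"
      using \<eta>(1) by (intro extensionalityI[of _ R]) (auto simp: \<theta>_def)
  qed
  ultimately show ?thesis by blast
qed

end
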